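(* Let $i\in\{1,2,3\}$ and consider the direct sum decomposition $$P=\sum_{N\in\mathbb N}\sum_{\ell\in\mathbb N}R_i^\ell\bigl({\rm Ker}(L_i)\cap P_N\bigr).$$ (i) Each summand is an irreducible submodule for the $i$th Lie subalgebra of $\mathfrak{sl}_4(\mathbb C)$ isomorphic to $\mathfrak{sl}_2(\mathbb C)\oplus\mathfrak{sl}_2(\mathbb C)$. (ii) For $N,\ell\in\mathbb N$ the summand $R_i^\ell\bigl({\rm Ker}(L_i)\cap P_N\bigr)$ is isomorphic to $\mathbb V_N\otimes\mathbb V_N$ as a module for the $i$th Lie subalgebra of $\mathfrak{sl}_4(\mathbb C)$ isomorphic to $\mathfrak{sl}_2(\mathbb C)\oplus\mathfrak{sl}_2(\mathbb C)$.
   Context: $\mathbb N=\{0,1,2,\ldots\}$. With $E_{a,b}$ the $4\times4$ matrix units, define in $\mathfrak{sl}_4(\mathbb C)$: $A_1=E_{12}+E_{21}+E_{34}+E_{43}$, $A_2=E_{13}+E_{31}+E_{24}+E_{42}$, $A_3=E_{14}+E_{41}+E_{23}+E_{32}$, $A_1^*={\rm diag}(1,1,-1,-1)$, $A_2^*={\rm diag}(1,-1,1,-1)$, $A_3^*={\rm diag}(1,-1,-1,1)$. $P=\mathbb C[x,y,z,w]$ is an $\mathfrak{sl}_4(\mathbb C)$-module on which every element acts as a derivation, and on the degree-one part $\varphi\in\mathfrak{sl}_4(\mathbb C)$ acts by its matrix with respect to the ordered basis $(v_1,v_2,v_3,v_4)=(x,y,z,w)$, i.e. $\varphi v_b=\sum_a\varphi_{ab}v_a$.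 $P_N$ is the subspace of homogeneous polynomials of total degree $N$. With $D_x,D_y,D_z,D_w$ the partial derivatives, $L_i,R_i\in{\rm End}(P)$ are $L_1=D_xD_y-D_zD_w$, $L_2=D_xD_z-D_wD_y$, $L_3=D_xD_w-D_yD_z$; $R_1(f)=(xy-zw)f$, $R_2(f)=(xz-wy)f$, $R_3(f)=(xw-yz)f$. The $i$th Lie subalgebra of $\mathfrak{sl}_4(\mathbb C)$ isomorphic to $\mathfrak{sl}_2(\mathbb C)\oplus\mathfrak{sl}_2(\mathbb C)$ is the Lie subalgebra generated by $A_j,A_k,A_j^*,A_k^*$, where $j,k$ are the two elements of $\{1,2,3\}\setminus\{i\}$. It is identified with $\mathfrak{sl}_2(\mathbb C)\oplus\mathfrak{sl}_2(\mathbb C)$ via the isomorphism $(A,0)\mapsto A_j$, $(A^*,0)\mapsto A_k^*$, $(0,A)\mapsto A_k$, $(0,A^* )\mapsto A_j^*$, where $A=\begin{pmatrix}0&1\\1&0\end{pmatrix}$ and $A^*={\rm diag}(1,-1)$ (generators of $\mathfrak{sl}_2(\mathbb C)$). $\mathbb V_N$ is the irreducible $\mathfrak{sl}_2(\mathbb C)$-module of dimension $N+1$, and $(a,b)\in\mathfrak{sl}_2(\mathbb C)\oplus\mathfrak{sl}_2(\mathbb C)$ acts on $\mathbb V_N\otimes\mathbb V_N$ by $u\otimes v\mapsto(au)\otimes v+u\otimes(bv)$. *)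

theory Defs
  imports "HOL-Analysis.Analysis" "HOL-Library.Poly_Mapping"
begin

section \<open>Finitely supported functions as complex vector spaces\<close>

definition pscale :: "complex \<Rightarrow> ('x \<Rightarrow>\<^sub>0 complex) \<Rightarrow> ('x \<Rightarrow>\<^sub>0 complex)" where
  "pscale c f = Poly_Mapping.map ((*) c) f"

lemma lookup_pscale [simp]: "Poly_Mapping.lookup (pscale c f) m = c * Poly_Mapping.lookup f m"
  unfolding pscale_def by transfer (simp add: when_def)

global_interpretation pvs: vector_space pscale
  by standard (auto intro!: poly_mapping_eqI simp: lookup_add algebra_simps)

definition internal_direct_sum ::
    "('i \<Rightarrow> ('x \<Rightarrow>\<^sub>0 complex) set) \<Rightarrow> ('x \<Rightarrow>\<^sub>0 complex) set \<Rightarrow> bool" where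
  "internal_direct_sum W V \<longleftrightarrow>
     pvs.subspace V \<and> (\<forall>k. pvs.subspace (W k) \<and> W k \<subseteq> V) \<and>
     (\<forall>f\<in>V. \<exists>!g. (\<forall>k. g k \<in> W k) \<and> finite {k. g k \<noteq> 0} \<and> f = (\<Sum>k | g k \<noteq> 0. g k))"


section \<open>Polynomials and their partial derivatives\<close>

text \<open>A monomial is its exponent vector \<^typ>\<open>'n \<Rightarrow>\<^sub>0 nat\<close>; multiplication on
  \<^typ>\<open>('n \<Rightarrow>\<^sub>0 nat) \<Rightarrow>\<^sub>0 complex\<close> is the usual product of polynomials.\<close>

type_synonym 'n cpoly = "('n \<Rightarrow>\<^sub>0 nat) \<Rightarrow>\<^sub>0 complex"

definition var :: "'n \<Rightarrow> 'n cpoly" where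
  "var a = Poly_Mapping.single (Poly_Mapping.single a 1) 1"

text \<open>If \<open>b\<close> does not occur in a monomial, the truncated subtraction is harmless because the
  coefficient vanishes.\<close>

definition pd :: "'n \<Rightarrow> 'n cpoly \<Rightarrow> 'n cpoly" where
  "pd b f = (\<Sum>m\<in>Poly_Mapping.keys f.
     Poly_Mapping.single (m - Poly_Mapping.single b 1)
       (of_nat (Poly_Mapping.lookup m b) * Poly_Mapping.lookup f m))"

definition homog :: "nat \<Rightarrow> ('n::finite) cpoly set" where
  "homog N = {f. \<forall>m\<in>Poly_Mapping.keys f. (\<Sum>a\<in>UNIV. Poly_Mapping.lookup m a) = N}"


section \<open>Special linear Lie algebras and their action by derivations\<close>

definition mscale :: "complex \<Rightarrow> complex^'n^'n \<Rightarrow> complex^'n^'n" where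
  "mscale c X = (\<chi> r s. c * X $ r $ s)"

definition lie :: "complex^'n^'n \<Rightarrow> complex^'n^'n \<Rightarrow> complex^'n^'n" where
  "lie X Y = X ** Y - Y ** X"

definition sl :: "(complex^'n^'n) set" where
  "sl = {X. trace X = 0}"

definition lie_subalgebra :: "(complex^'n^'n) set \<Rightarrow> bool" where
  "lie_subalgebra G \<longleftrightarrow> G \<subseteq> sl \<and> 0 \<in> G \<and> (\<forall>X\<in>G. \<forall>Y\<in>G. X + Y \<in> G) \<and>
     (\<forall>c. \<forall>X\<in>G. mscale c X \<in> G) \<and> (\<forall>X\<in>G. \<forall>Y\<in>G. lie X Y \<in> G)"

text \<open>The derivation whose values on the variables are given by the columns of \<open>X\<close>; it is pinned
  down by \<open>act_var\<close> and \<open>act_unique\<close> below, and \<open>act_lie\<close> shows that it is a Lie algebra action.\<close>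

definition act :: "complex^'n^'n \<Rightarrow> ('n::finite) cpoly \<Rightarrow> 'n cpoly" where
  "act X f = (\<Sum>a\<in>UNIV. \<Sum>b\<in>UNIV. pscale (X $ a $ b) (var a * pd b f))"

definition is_submodule ::
    "'g set \<Rightarrow> ('g \<Rightarrow> ('x \<Rightarrow>\<^sub>0 complex) \<Rightarrow> ('x \<Rightarrow>\<^sub>0 complex)) \<Rightarrow> ('x \<Rightarrow>\<^sub>0 complex) set \<Rightarrow> bool" where
  "is_submodule G \<rho> W \<longleftrightarrow> pvs.subspace W \<and> (\<forall>X\<in>G. \<forall>w\<in>W. \<rho> X w \<in> W)"

definition is_irreducible_submodule ::
    "'g set \<Rightarrow> ('g \<Rightarrow> ('x \<Rightarrow>\<^sub>0 complex) \<Rightarrow> ('x \<Rightarrow>\<^sub>0 complex)) \<Rightarrow> ('x \<Rightarrow>\<^sub>0 complex) set \<Rightarrow> bool" where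
  "is_irreducible_submodule G \<rho> W \<longleftrightarrow> is_submodule G \<rho> W \<and> W \<noteq> {0} \<and>
     (\<forall>U. is_submodule G \<rho> U \<and> U \<subseteq> W \<longrightarrow> U = {0} \<or> U = W)"

text \<open>A module \<open>V\<close> for \<open>G\<close> and a module \<open>W\<close> for \<open>\<theta> ` G\<close> are isomorphic when \<open>\<theta> ` G\<close> is
  identified with \<open>G\<close> via \<open>\<theta>\<close>.\<close>

definition module_isomorphic ::
    "('g \<Rightarrow> 'h) \<Rightarrow> 'g set \<Rightarrow>
     ('g \<Rightarrow> ('x \<Rightarrow>\<^sub>0 complex) \<Rightarrow> ('x \<Rightarrow>\<^sub>0 complex)) \<Rightarrow> ('x \<Rightarrow>\<^sub>0 complex) set \<Rightarrow>
     ('h \<Rightarrow> ('y \<Rightarrow>\<^sub>0 complex) \<Rightarrow> ('y \<Rightarrow>\<^sub>0 complex)) \<Rightarrow> ('y \<Rightarrow>\<^sub>0 complex) set \<Rightarrow> bool" where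
  "module_isomorphic \<theta> G \<rho> V \<sigma> W \<longleftrightarrow>
     (\<exists>T. bij_betw T V W \<and>
          (\<forall>u\<in>V. \<forall>v\<in>V. T (u + v) = T u + T v) \<and>
          (\<forall>c. \<forall>u\<in>V. T (pscale c u) = pscale c (T u)) \<and>
          (\<forall>g\<in>G. \<forall>u\<in>V. T (\<rho> g u) = \<sigma> (\<theta> g) (T u)))"


section \<open>Matrices and operators\<close>

definition E :: "'n \<Rightarrow> 'n \<Rightarrow> complex^'n^'n" where
  "E a b = (\<chi> r s. if r = a \<and> s = b then 1 else 0)"

definition diag :: "complex^'n \<Rightarrow> complex^'n^'n" where
  "diag d = (\<chi> r s. if r = s then d $ r else 0)"

text \<open>The indices 1, 2, 3, 4 of type \<^typ>\<open>4\<close> stand for \<open>x, y, z, w\<close>. The families below are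
  only meant for \<open>i \<in> {1, 2, 3}\<close>.\<close>

definition A :: "nat \<Rightarrow> complex^4^4" where
  "A i = (if i = 1 then E 1 2 + E 2 1 + E 3 4 + E 4 3
          else if i = 2 then E 1 3 + E 3 1 + E 2 4 + E 4 2
          else E 1 4 + E 4 1 + E 2 3 + E 3 2)"

definition Astar :: "nat \<Rightarrow> complex^4^4" where
  "Astar i = (if i = 1 then diag (vector [1, 1, -1, -1])
              else if i = 2 then diag (vector [1, -1, 1, -1])
              else diag (vector [1, -1, -1, 1]))"

definition L :: "nat \<Rightarrow> 4 cpoly \<Rightarrow> 4 cpoly" where
  "L i f = (if i = 1 then pd 1 (pd 2 f) - pd 3 (pd 4 f)
            else if i = 2 then pd 1 (pd 3 f) - pd 4 (pd 2 f)
            else pd 1 (pd 4 f) - pd 2 (pd 3 f))"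

definition R :: "nat \<Rightarrow> 4 cpoly \<Rightarrow> 4 cpoly" where
  "R i f = (if i = 1 then (var 1 * var 2 - var 3 * var 4) * f
            else if i = 2 then (var 1 * var 3 - var 4 * var 2) * f
            else (var 1 * var 4 - var 2 * var 3) * f)"

definition summand :: "nat \<Rightarrow> nat \<Rightarrow> nat \<Rightarrow> 4 cpoly set" where
  "summand i N l = (R i ^^ l) ` ({f. L i f = 0} \<inter> homog N)"

definition lie_sub :: "nat \<Rightarrow> (complex^4^4) set" where
  "lie_sub i = lie_subalgebra hull (\<Union>j\<in>{1, 2, 3} - {i}. {A j, Astar j})"


section \<open>The identification with a direct sum of two copies of the rank one algebra\<close>

definition A2 :: "complex^2^2" where
  "A2 = vector [vector [0, 1], vector [1, 0]]"

definition A2star :: "complex^2^2" where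
  "A2star = diag (vector [1, -1])"

definition sl2_identification ::
    "nat \<Rightarrow> nat \<Rightarrow> nat \<Rightarrow> ((complex^2^2) \<times> (complex^2^2) \<Rightarrow> complex^4^4) \<Rightarrow> bool" where
  "sl2_identification i j k \<theta> \<longleftrightarrow>
     bij_betw \<theta> (sl \<times> sl) (lie_sub i) \<and>
     (\<forall>p\<in>sl \<times> sl. \<forall>q\<in>sl \<times> sl. \<theta> (p + q) = \<theta> p + \<theta> q) \<and>
     (\<forall>c. \<forall>a\<in>sl. \<forall>b\<in>sl. \<theta> (mscale c a, mscale c b) = mscale c (\<theta> (a, b))) \<and>
     (\<forall>a\<in>sl. \<forall>b\<in>sl. \<forall>a'\<in>sl. \<forall>b'\<in>sl. \<theta> (lie a a', lie b b') = lie (\<theta> (a, b)) (\<theta> (a', b'))) \<and>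
     \<theta> (A2, 0) = A j \<and> \<theta> (A2star, 0) = Astar k \<and>
     \<theta> (0, A2) = A k \<and> \<theta> (0, A2star) = Astar j"


section \<open>The irreducible modules and their tensor squares\<close>

text \<open>The irreducible module of dimension \<open>N + 1\<close> is realised on binary forms of degree \<open>N\<close>;
  see \<open>VN_irreducible\<close> and \<open>VN_dim\<close> below.\<close>

definition VN :: "nat \<Rightarrow> 2 cpoly set" where
  "VN N = homog N"

text \<open>The tensor product of the spaces freely generated by two sets is freely generated by the
  product of the sets.\<close>

definition tensor :: "('x \<Rightarrow>\<^sub>0 complex) \<Rightarrow> ('y \<Rightarrow>\<^sub>0 complex) \<Rightarrow> ('x \<times> 'y \<Rightarrow>\<^sub>0 complex)" where
  "tensor u v = (\<Sum>m\<in>Poly_Mapping.keys u. \<Sum>n\<in>Poly_Mapping.keys v.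
     Poly_Mapping.single (m, n) (Poly_Mapping.lookup u m * Poly_Mapping.lookup v n))"

definition tensor_space ::
    "('x \<Rightarrow>\<^sub>0 complex) set \<Rightarrow> ('y \<Rightarrow>\<^sub>0 complex) set \<Rightarrow> ('x \<times> 'y \<Rightarrow>\<^sub>0 complex) set" where
  "tensor_space U V = pvs.span {tensor u v | u v. u \<in> U \<and> v \<in> V}"

text \<open>Linear extension, from the basis of tensors of monomials, of
  \<open>u \<otimes> v \<mapsto> (a u) \<otimes> v + u \<otimes> (b v)\<close>; see \<open>tensor_act_tensor\<close> below for general pure tensors.\<close>

definition tensor_act ::
    "(complex^2^2) \<times> (complex^2^2) \<Rightarrow> ((2 \<Rightarrow>\<^sub>0 nat) \<times> (2 \<Rightarrow>\<^sub>0 nat) \<Rightarrow>\<^sub>0 complex) \<Rightarrow>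
     ((2 \<Rightarrow>\<^sub>0 nat) \<times> (2 \<Rightarrow>\<^sub>0 nat) \<Rightarrow>\<^sub>0 complex)" where
  "tensor_act = (\<lambda>(a, b) t. \<Sum>(m, n)\<in>Poly_Mapping.keys t. pscale (Poly_Mapping.lookup t (m, n))
     (tensor (act a (Poly_Mapping.single m 1)) (Poly_Mapping.single n 1) +
      tensor (Poly_Mapping.single m 1) (act b (Poly_Mapping.single n 1))))"


section \<open>Adequacy of the definitions\<close>

subsection \<open>Partial derivatives and the action by derivations\<close>

lemma lookup_pd:
  "Poly_Mapping.lookup (pd b f) m =
     of_nat (Poly_Mapping.lookup m b + 1) * Poly_Mapping.lookup f (m + Poly_Mapping.single b 1)"
proof -
  let ?e = "Poly_Mapping.single b (1::nat)"
  have eq: "Poly_Mapping.lookup (Poly_Mapping.single (k - ?e)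
        (of_nat (Poly_Mapping.lookup k b) * Poly_Mapping.lookup f k)) m
      = (if k = m + ?e then of_nat (Poly_Mapping.lookup m b + 1) * Poly_Mapping.lookup f k else 0)" for k
  proof (cases "Poly_Mapping.lookup k b = 0")
    case True
    then have "k \<noteq> m + ?e" by (auto simp: lookup_add)
    then show ?thesis using True by simp
  next
    case False
    then have "k - ?e = m \<longleftrightarrow> k = m + ?e"
      by (auto simp: poly_mapping_eq_iff fun_eq_iff lookup_add lookup_minus lookup_single when_def)
    then show ?thesis by (auto simp: lookup_single when_def lookup_add)
  qed
  show ?thesis
    unfolding pd_def lookup_sum eq
    by (simp add: sum.delta in_keys_iff)
qed

lemma pd_add: "pd b (f + g) = pd b f + pd b g"
  by (rule poly_mapping_eqI) (simp add: lookup_pd lookup_add algebra_simps)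

lemma pd_pscale: "pd b (pscale c f) = pscale c (pd b f)"
  by (rule poly_mapping_eqI) (simp add: lookup_pd)

lemma pd_sum: "pd b (\<Sum>x\<in>S. h x) = (\<Sum>x\<in>S. pd b (h x))"
proof -
  have "pd b 0 = 0" by (simp add: pd_def)
  then show ?thesis by (induct S rule: infinite_finite_induct) (auto simp: pd_add)
qed

lemma pd_single: "pd b (Poly_Mapping.single m c) =
    Poly_Mapping.single (m - Poly_Mapping.single b 1) (of_nat (Poly_Mapping.lookup m b) * c)"
  by (cases "c = 0") (simp_all add: pd_def)

lemma pm_expand: "f = (\<Sum>m\<in>Poly_Mapping.keys f. Poly_Mapping.single m (Poly_Mapping.lookup f m))"
  by (rule poly_mapping_eqI) (simp add: lookup_sum lookup_single when_def in_keys_iff)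

lemma pd_mult_single:
  "pd b (Poly_Mapping.single m c * Poly_Mapping.single n d) =
     pd b (Poly_Mapping.single m c) * Poly_Mapping.single n d +
     Poly_Mapping.single m c * pd b (Poly_Mapping.single n d)"
proof -
  let ?e = "Poly_Mapping.single b (1::nat)"
  have 1: "m - ?e + n = m + n - ?e" if "Poly_Mapping.lookup m b \<noteq> 0"
    using that by (intro poly_mapping_eqI) (auto simp: lookup_add lookup_minus lookup_single when_def)
  have 2: "m + (n - ?e) = m + n - ?e" if "Poly_Mapping.lookup n b \<noteq> 0"
    using that by (intro poly_mapping_eqI) (auto simp: lookup_add lookup_minus lookup_single when_def)
  show ?thesis
    using 1 2
    by (cases "Poly_Mapping.lookup m b = 0"; cases "Poly_Mapping.lookup n b = 0")
       (auto simp: pd_single mult_single lookup_add single_add[symmetric] distrib_left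
         distrib_right mult.assoc mult.left_commute)
qed

lemma pd_mult: "pd b (f * g) = pd b f * g + f * pd b g"
proof -
  let ?F = "\<lambda>m. Poly_Mapping.single m (Poly_Mapping.lookup f m)"
  let ?G = "\<lambda>m. Poly_Mapping.single m (Poly_Mapping.lookup g m)"
  let ?f = "\<Sum>m\<in>Poly_Mapping.keys f. ?F m" and ?g = "\<Sum>m\<in>Poly_Mapping.keys g. ?G m"
  have "pd b (?f * ?g) = pd b ?f * ?g + ?f * pd b ?g"
    by (simp add: sum_product pd_sum pd_mult_single sum.distrib)
  then show ?thesis by (simp only: pm_expand[symmetric])
qed

lemma pd_var: "pd b (var a) = (if a = b then 1 else 0)"
  by (auto simp: var_def pd_single lookup_single when_def single_one)

lemma pscale_mult: "pscale c f * g = pscale c (f * g)" "f * pscale c g = pscale c (f * g)"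
  for f g :: "'n cpoly"
  by (simp_all add: pscale_def mult_map_scale_conv_mult mult.assoc mult.left_commute[of f])

lemma act_add: "act X (f + g) = act X f + act X g"
  by (simp add: act_def pd_add distrib_left pvs.scale_right_distrib sum.distrib)

lemma act_pscale: "act X (pscale c f) = pscale c (act X f)"
  by (simp add: act_def pd_pscale pscale_mult pvs.scale_sum_right mult.commute)

lemma act_derivation: "act X (f * g) = act X f * g + f * act X g"
  by (simp add: act_def pd_mult distrib_left pvs.scale_right_distrib sum.distrib
      sum_distrib_left sum_distrib_right pscale_mult ac_simps)

lemma act_var: "act X (var b) = (\<Sum>a\<in>UNIV. pscale (X $ a $ b) (var a))"
proof -
  have "pscale (X $ a $ c) (var a * pd c (var b)) = (if c = b then pscale (X $ a $ b) (var a) else 0)" for a c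
    by (simp add: pd_var)
  then show ?thesis by (simp add: act_def)
qed

lemma act_unique:
  fixes d :: "('n::finite) cpoly \<Rightarrow> 'n cpoly"
  assumes add: "\<And>f g. d (f + g) = d f + d g"
    and scale: "\<And>c f. d (pscale c f) = pscale c (d f)"
    and mult: "\<And>f g. d (f * g) = d f * g + f * d g"
    and var: "\<And>b. d (var b) = (\<Sum>a\<in>UNIV. pscale (X $ a $ b) (var a))"
  shows "d = act X"
proof
  fix f
  have one: "d 1 = 0" "act X 1 = 0"
    using mult[of 1 1] act_derivation[of X 1 1] by simp_all
  have zero: "d 0 = 0" "act X 0 = 0"
    using add[of 0 0] act_add[of X 0 0] by simp_all
  have mon: "d (Poly_Mapping.single m 1) = act X (Poly_Mapping.single m 1)" for m
  proof (induction "\<Sum>a\<in>UNIV. Poly_Mapping.lookup m a" arbitrary: m)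
    case 0
    then have "m = 0" by (intro poly_mapping_eqI) simp
    then show ?case by (simp add: one)
  next
    case (Suc k)
    obtain a where a: "Poly_Mapping.lookup m a \<noteq> 0"
    proof (rule ccontr)
      assume "\<not> thesis"
      then have "\<And>a. Poly_Mapping.lookup m a = 0" using that by blast
      then show False using Suc(2) by simp
    qed
    define n where "n = m - Poly_Mapping.single a 1"
    have m: "m = Poly_Mapping.single a 1 + n"
      using a unfolding n_def
      by (intro poly_mapping_eqI) (auto simp: lookup_add lookup_minus lookup_single when_def)
    have "(\<Sum>a\<in>UNIV. Poly_Mapping.lookup m a) = 1 + (\<Sum>a\<in>UNIV. Poly_Mapping.lookup n a)"
      by (simp add: m lookup_add sum.distrib lookup_single when_def)
    then have "k = (\<Sum>a\<in>UNIV. Poly_Mapping.lookup n a)" using Suc(2) by simp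
    then have IH: "d (Poly_Mapping.single n 1) = act X (Poly_Mapping.single n 1)"
      by (rule Suc(1))
    have "Poly_Mapping.single m 1 = var a * Poly_Mapping.single n (1::complex)"
      by (simp add: var_def mult_single m)
    then show ?case by (simp add: mult act_derivation var act_var IH)
  qed
  have sing: "d (Poly_Mapping.single m c) = act X (Poly_Mapping.single m c)" for m c
  proof -
    have "Poly_Mapping.single m c = pscale c (Poly_Mapping.single m 1)"
      by (rule poly_mapping_eqI) (simp add: lookup_single when_def)
    then show ?thesis by (simp add: scale act_pscale mon)
  qed
  have "d (\<Sum>x\<in>S. h x) = (\<Sum>x\<in>S. d (h x))" "act X (\<Sum>x\<in>S. h x) = (\<Sum>x\<in>S. act X (h x))"
    for S :: "('n \<Rightarrow>\<^sub>0 nat) set" and h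
    by (induct S rule: infinite_finite_induct) (simp_all add: zero add act_add)
  then have "d (\<Sum>m\<in>Poly_Mapping.keys f. Poly_Mapping.single m (Poly_Mapping.lookup f m)) =
      act X (\<Sum>m\<in>Poly_Mapping.keys f. Poly_Mapping.single m (Poly_Mapping.lookup f m))"
    by (simp add: sing)
  then show "d f = act X f" by (simp only: pm_expand[symmetric])
qed

lemma act_linear_left:
  "act (X + Y) f = act X f + act Y f" "act (mscale c X) f = pscale c (act X f)"
  by (simp_all add: act_def mscale_def pvs.scale_left_distrib sum.distrib pvs.scale_sum_right)

lemma act_0: "act X 0 = 0"
  using act_pscale[of X 0 0] by simp

lemma act_sum: "act Z (\<Sum>x\<in>S. h x) = (\<Sum>x\<in>S. act Z (h x))"
  by (induct S rule: infinite_finite_induct) (simp_all add: act_add act_0)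

lemma act_lie: "act (lie X Y) f = act X (act Y f) - act Y (act X f)"
proof -
  have vv: "act Z (act W (var b)) = (\<Sum>a\<in>UNIV. pscale ((Z ** W) $ a $ b) (var a))" for Z W b
  proof -
    have "act Z (act W (var b)) =
        (\<Sum>c\<in>UNIV. \<Sum>a\<in>UNIV. pscale (Z $ a $ c * W $ c $ b) (var a))"
      by (simp add: act_var[of W] act_sum act_pscale)
        (simp add: act_var pvs.scale_sum_right mult.commute)
    also have "\<dots> = (\<Sum>a\<in>UNIV. \<Sum>c\<in>UNIV. pscale (Z $ a $ c * W $ c $ b) (var a))"
      by (rule sum.swap)
    finally show ?thesis by (simp add: matrix_matrix_mult_def pvs.scale_sum_left)
  qed
  have "(\<lambda>f. act X (act Y f) - act Y (act X f)) = act (lie X Y)"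
    by (rule act_unique)
       (simp_all add: act_add act_pscale act_derivation vv pvs.scale_right_diff_distrib lie_def
         pvs.scale_left_diff_distrib sum_subtractf algebra_simps)
  then show ?thesis by (metis (no_types))
qed

lemma act_E: "act (E a b) f = var a * pd b f"
proof -
  have "pscale (E a b $ c $ e) (var c * pd e f) =
      (if e = b then (if c = a then var a * pd b f else 0) else 0)" for c e
    by (simp add: E_def)
  then show ?thesis by (simp add: act_def)
qed


subsection \<open>Pure tensors\<close>

lemma lookup_tensor [simp]:
  "Poly_Mapping.lookup (tensor u v) (m, n) = Poly_Mapping.lookup u m * Poly_Mapping.lookup v n"
proof -
  have "Poly_Mapping.lookup (tensor u v) (m, n) =
     (\<Sum>m'\<in>Poly_Mapping.keys u. \<Sum>n'\<in>Poly_Mapping.keys v.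
        if n' = n then (if m' = m then Poly_Mapping.lookup u m * Poly_Mapping.lookup v n else 0) else 0)"
    unfolding tensor_def lookup_sum
    by (intro sum.cong refl) (auto simp: lookup_single when_def)
  then show ?thesis
    by (cases "Poly_Mapping.lookup u m = 0"; cases "Poly_Mapping.lookup v n = 0")
       (simp_all add: in_keys_iff)
qed

lemma tensor_act_tensor:
  "tensor_act (a, b) (tensor u v) = tensor (act a u) v + tensor u (act b v)"
proof -
  have add1: "tensor (f + g) h = tensor f h + tensor g h"
    and add2: "tensor k (p + q) = tensor k p + tensor k q"
    and sc1: "tensor (pscale c f) h = pscale c (tensor f h)"
    and sc2: "tensor k (pscale c p) = pscale c (tensor k p)"
    and z1: "tensor 0 h = (0 :: 'x \<times> 'y \<Rightarrow>\<^sub>0 complex)"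
    and z2: "tensor k 0 = (0 :: 'x \<times> 'y \<Rightarrow>\<^sub>0 complex)"
    for f g k :: "'x \<Rightarrow>\<^sub>0 complex" and h p q :: "'y \<Rightarrow>\<^sub>0 complex" and c
    by (auto intro!: poly_mapping_eqI simp: lookup_add algebra_simps)
  have s1: "tensor (\<Sum>x\<in>S. F x) h = (\<Sum>x\<in>S. tensor (F x) h)" 
    for S and F :: "'i \<Rightarrow> ('x \<Rightarrow>\<^sub>0 complex)" and h :: "'y \<Rightarrow>\<^sub>0 complex"
    by (induct S rule: infinite_finite_induct) (simp_all add: add1 z1)
  have s2: "tensor h (\<Sum>x\<in>S. F x) = (\<Sum>x\<in>S. tensor h (F x))" 
    for S and F :: "'i \<Rightarrow> ('y \<Rightarrow>\<^sub>0 complex)" and h :: "'x \<Rightarrow>\<^sub>0 complex"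
    by (induct S rule: infinite_finite_induct) (simp_all add: add2 z2)
  let ?s = "\<lambda>m. Poly_Mapping.single m (1::complex)"
  have sing: "Poly_Mapping.single m c = pscale c (?s m)" for m c
    by (rule poly_mapping_eqI) (simp add: lookup_single when_def)
  have exp: "f = (\<Sum>m\<in>Poly_Mapping.keys f. pscale (Poly_Mapping.lookup f m) (?s m))" for f
    by (subst pm_expand) (simp only: sing[symmetric])
  have keys: "Poly_Mapping.keys (tensor u v) = Poly_Mapping.keys u \<times> Poly_Mapping.keys v"
    by (auto simp: in_keys_iff)
  let ?f = "Poly_Mapping.lookup u" and ?g = "Poly_Mapping.lookup v"
  let ?K = "Poly_Mapping.keys u" and ?L = "Poly_Mapping.keys v"
  have 1: "tensor (act a u) v =
      (\<Sum>m\<in>?K. \<Sum>n\<in>?L. pscale (?f m * ?g n) (tensor (act a (?s m)) (?s n)))"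
    by (subst exp[of u], subst exp[of v], simp only: act_sum act_pscale s1 s2 sc1 sc2
        pvs.scale_scale sum_distrib_left pvs.scale_sum_right) (subst sum.swap, simp add: mult.commute)
  have 2: "tensor u (act b v) =
      (\<Sum>m\<in>?K. \<Sum>n\<in>?L. pscale (?f m * ?g n) (tensor (?s m) (act b (?s n))))"
    by (subst exp[of u], subst exp[of v], simp only: act_sum act_pscale s1 s2 sc1 sc2
        pvs.scale_scale sum_distrib_left pvs.scale_sum_right) (subst sum.swap, simp add: mult.commute)
  show ?thesis
    by (simp add: tensor_act_def keys 1 2 pvs.scale_right_distrib
        sum.cartesian_product[symmetric] sum.distrib)
qed


subsection \<open>Binary forms\<close>

lemma lookup_var_mult:
  "Poly_Mapping.lookup (var a * f) (m + Poly_Mapping.single a 1) = Poly_Mapping.lookup f m"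
proof -
  let ?e = "Poly_Mapping.single a (1::nat)"
  let ?f = "\<Sum>k\<in>Poly_Mapping.keys f. Poly_Mapping.single k (Poly_Mapping.lookup f k)"
  have "Poly_Mapping.lookup (var a * ?f) (m + ?e) = Poly_Mapping.lookup f m"
    by (simp add: var_def sum_distrib_left mult_single lookup_sum lookup_single when_def
        add.commute[of "Poly_Mapping.single a (Suc 0)"] in_keys_iff)
  then show ?thesis by (simp only: pm_expand[symmetric])
qed

definition mon2 :: "nat \<Rightarrow> nat \<Rightarrow> (2 \<Rightarrow>\<^sub>0 nat)" where
  "mon2 p q = Poly_Mapping.single 1 p + Poly_Mapping.single 2 q"

lemma lookup_mon2 [simp]:
  "Poly_Mapping.lookup (mon2 p q) 1 = p" "Poly_Mapping.lookup (mon2 p q) 2 = q"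
  by (simp_all add: mon2_def lookup_add lookup_single)

lemma mon2_eta: "m = mon2 (Poly_Mapping.lookup m 1) (Poly_Mapping.lookup m 2)"
proof (rule poly_mapping_eqI)
  fix k :: 2
  show "Poly_Mapping.lookup m k = Poly_Mapping.lookup (mon2 (Poly_Mapping.lookup m 1) (Poly_Mapping.lookup m 2)) k"
    using exhaust_2[of k] by (elim disjE) (simp_all del: One_nat_def)
qed

lemma mon2_eq_iff: "mon2 p q = mon2 r s \<longleftrightarrow> p = r \<and> q = s"
  by (metis lookup_mon2)

lemma homog_subspace: "pvs.subspace (homog N)"
  unfolding pvs.subspace_def
  by (auto simp: homog_def in_keys_iff lookup_add)

lemma VN_iff: "f \<in> VN N \<longleftrightarrow> (\<forall>m. Poly_Mapping.lookup f m \<noteq> 0 \<longrightarrow>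
    (\<exists>q\<le>N. m = mon2 (N - q) q))"
proof -
  have "Poly_Mapping.lookup m 1 + Poly_Mapping.lookup m 2 = N \<longleftrightarrow> (\<exists>q\<le>N. m = mon2 (N - q) q)" for m
    using mon2_eta[of m] by (auto simp: mon2_eq_iff) (metis add_diff_cancel_right' le_add2)
  then show ?thesis by (auto simp: VN_def homog_def in_keys_iff sum_2)
qed

lemma binary_inj: "inj_on (\<lambda>q. Poly_Mapping.single (mon2 (N - q) q) (1::complex)) S"
proof (rule inj_onI)
  fix p q
  assume "Poly_Mapping.single (mon2 (N - p) p) (1::complex) = Poly_Mapping.single (mon2 (N - q) q) 1"
  then have "Poly_Mapping.keys (Poly_Mapping.single (mon2 (N - p) p) (1::complex)) =
      Poly_Mapping.keys (Poly_Mapping.single (mon2 (N - q) q) (1::complex))" by (rule arg_cong)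
  then show "p = q" by (simp add: mon2_eq_iff)
qed

lemma VN_basis:
  shows "pvs.independent ((\<lambda>q. Poly_Mapping.single (mon2 (N - q) q) 1) ` {..N})"
    and "pvs.span ((\<lambda>q. Poly_Mapping.single (mon2 (N - q) q) 1) ` {..N}) = VN N"
proof -
  let ?b = "\<lambda>q. Poly_Mapping.single (mon2 (N - q) q) (1::complex)"
  have inj: "inj_on ?b {..N}"
    by (rule binary_inj)
  show "pvs.independent (?b ` {..N})"
  proof (rule pvs.independent_if_scalars_zero)
    fix g x
    assume s: "(\<Sum>x\<in>?b ` {..N}. pscale (g x) x) = 0" and "x \<in> ?b ` {..N}"
    then obtain q where q: "q \<le> N" "x = ?b q" by auto
    have "0 = Poly_Mapping.lookup (\<Sum>p\<le>N. pscale (g (?b p)) (?b p)) (mon2 (N - q) q)"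
      using s by (simp add: sum.reindex[OF inj] o_def)
    also have "\<dots> = (\<Sum>p\<le>N. if p = q then g (?b q) else 0)"
      unfolding lookup_sum
      by (intro sum.cong refl) (auto simp: lookup_single when_def mon2_eq_iff)
    also have "\<dots> = g x" using q by simp
    finally show "g x = 0" by simp
  qed simp
  show "pvs.span (?b ` {..N}) = VN N"
  proof (rule antisym)
    show "pvs.span (?b ` {..N}) \<subseteq> VN N"
      by (rule pvs.span_minimal)
         (auto simp: VN_iff lookup_single when_def homog_subspace[of N, where 'a=2, folded VN_def])
    show "VN N \<subseteq> pvs.span (?b ` {..N})"
    proof
      fix f assume f: "f \<in> VN N"
      have "f = (\<Sum>m\<in>Poly_Mapping.keys f. pscale (Poly_Mapping.lookup f m) (Poly_Mapping.single m 1))"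
        by (rule poly_mapping_eqI)
           (simp add: lookup_sum lookup_single when_def in_keys_iff if_distrib cong: if_cong)
      moreover have "\<dots> \<in> pvs.span (?b ` {..N})"
        using f by (intro pvs.span_sum pvs.span_scale pvs.span_base) (auto simp: VN_iff in_keys_iff)
      ultimately show "f \<in> pvs.span (?b ` {..N})" by simp
    qed
  qed
qed

lemma VN_dim: "pvs.dim (VN N) = N + 1"
proof -
  let ?b = "\<lambda>q. Poly_Mapping.single (mon2 (N - q) q) (1::complex)"
  have inj: "inj_on ?b {..N}"
    by (rule binary_inj)
  have "pvs.dim (VN N) = card (?b ` {..N})"
    using pvs.dim_span_eq_card_independent[OF VN_basis(1)[of N]] by (simp add: VN_basis(2))
  then show ?thesis by (simp add: card_image[OF inj])
qed

lemma act_homog: "f \<in> homog N \<Longrightarrow> act X f \<in> homog N"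
proof -
  assume f: "f \<in> homog N"
  have "var a * pd b f \<in> homog N" for a b
  proof -
    let ?F = "\<lambda>m. Poly_Mapping.single m (Poly_Mapping.lookup f m)"
    let ?h = "\<Sum>m\<in>Poly_Mapping.keys f. ?F m"
    have "var a * pd b (?F m) \<in> homog N" if "m \<in> Poly_Mapping.keys f" for m
    proof (cases "Poly_Mapping.lookup m b = 0")
      case True then show ?thesis by (simp add: pd_single homog_def)
    next
      case False
      let ?n = "m - Poly_Mapping.single b 1"
      have "m = Poly_Mapping.single b 1 + ?n"
        using False by (intro poly_mapping_eqI) (auto simp: lookup_add lookup_minus lookup_single when_def)
      then have "(\<Sum>c\<in>UNIV. Poly_Mapping.lookup m c) =
          (\<Sum>c\<in>UNIV. Poly_Mapping.lookup (Poly_Mapping.single b 1 + ?n) c)" by simp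
      also have "\<dots> = (\<Sum>c\<in>UNIV. Poly_Mapping.lookup (Poly_Mapping.single a 1 + ?n) c)"
        by (simp add: lookup_add sum.distrib lookup_single when_def)
      finally have "(\<Sum>c\<in>UNIV. Poly_Mapping.lookup (Poly_Mapping.single a 1 + ?n) c) = N"
        using f that by (auto simp: homog_def)
      then show ?thesis
        by (simp add: pd_single var_def mult_single homog_def)
    qed
    then have "var a * pd b ?h \<in> homog N"
      unfolding pd_sum sum_distrib_left by (intro pvs.subspace_sum homog_subspace)
    then show ?thesis by (simp only: pm_expand[symmetric])
  qed
  then show "act X f \<in> homog N"
    unfolding act_def by (intro pvs.subspace_sum pvs.subspace_scale homog_subspace)
qed

theorem VN_irreducible: "is_irreducible_submodule sl act (VN N)"
  unfolding is_irreducible_submodule_def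
proof (intro conjI allI impI)
  let ?b = "\<lambda>q. Poly_Mapping.single (mon2 (N - q) q) (1::complex)"
  show "is_submodule sl act (VN N)"
    by (simp add: is_submodule_def VN_def act_homog homog_subspace)
  have "?b 0 \<in> VN N" by (auto simp: VN_iff lookup_single when_def)
  moreover have "?b 0 \<noteq> 0"
    by (metis lookup_single_eq lookup_zero zero_neq_one)
  ultimately show "VN N \<noteq> {0}" by auto
  fix U assume U: "is_submodule sl act U \<and> U \<subseteq> VN N"
  then have subU: "pvs.subspace U" and UV: "U \<subseteq> VN N"
    and clos: "\<And>X f. X \<in> sl \<Longrightarrow> f \<in> U \<Longrightarrow> act X f \<in> U"
    by (auto simp: is_submodule_def)
  have sl: "E 1 2 \<in> (sl :: (complex^2^2) set)" "E 2 1 \<in> (sl :: (complex^2^2) set)"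
    by (simp_all add: sl_def trace_def E_def sum_2)
  have up: "?b 0 \<in> U" if "f \<in> U" "f \<noteq> 0" "\<forall>m\<in>Poly_Mapping.keys f. Poly_Mapping.lookup m 2 \<le> d" for f d
    using that
  proof (induction d arbitrary: f)
    case 0
    have *: "m = mon2 N 0" if m: "Poly_Mapping.lookup f m \<noteq> 0" for m
    proof -
      have "f \<in> VN N" using 0 UV by blast
      then obtain q where "m = mon2 (N - q) q" using m unfolding VN_iff by blast
      moreover have "Poly_Mapping.lookup m 2 = 0" using m 0 by (auto simp: in_keys_iff)
      ultimately show ?thesis by simp
    qed
    let ?c = "Poly_Mapping.lookup f (mon2 N 0)"
    have "?c \<noteq> 0" using * 0(2) by (metis poly_mapping_eqI lookup_zero)
    moreover have "f = pscale ?c (?b 0)"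
      using * by (intro poly_mapping_eqI) (auto simp: lookup_single when_def)
    ultimately have "?b 0 = pscale (inverse ?c) f"
      by (metis pvs.scale_scale pvs.scale_one left_inverse)
    then show ?case using subU 0(1) by (metis pvs.subspace_scale)
  next
    case (Suc d)
    let ?g = "act (E 1 2) f"
    have g: "?g = var 1 * pd 2 f" by (rule act_E)
    show ?case
    proof (cases "?g = 0")
      case True
      have "Poly_Mapping.lookup m 2 = 0" if "m \<in> Poly_Mapping.keys f" for m
      proof (rule ccontr)
        assume "Poly_Mapping.lookup m 2 \<noteq> 0"
        then have m: "m = (m - Poly_Mapping.single 2 1) + Poly_Mapping.single 2 1"
          by (intro poly_mapping_eqI) (auto simp: lookup_add lookup_minus lookup_single when_def)
        let ?n = "m - Poly_Mapping.single 2 1"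
        have "Poly_Mapping.lookup (var 1 * pd 2 f) (?n + Poly_Mapping.single 1 1) = 0"
          by (simp only: True g[symmetric] lookup_zero)
        then have "Poly_Mapping.lookup (pd 2 f) ?n = 0" by (simp only: lookup_var_mult)
        then have "Poly_Mapping.lookup f m = 0"
          unfolding lookup_pd m[symmetric] by (simp only: mult_eq_0_iff of_nat_eq_0_iff) simp
        then show False using that by (simp add: in_keys_iff)
      qed
      then show ?thesis using Suc.IH[of f] Suc.prems by simp
    next
      case False
      have gU: "?g \<in> U" using clos sl Suc.prems by blast
      have "Poly_Mapping.lookup m 2 \<le> d" if m: "m \<in> Poly_Mapping.keys ?g" for m
      proof -
        have "m \<in> {x + y | x y. x \<in> Poly_Mapping.keys (var (1::2)) \<and> y \<in> Poly_Mapping.keys (pd 2 f)}"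
          using m keys_mult[of "var 1" "pd 2 f"] unfolding g by blast
        then obtain n where n: "n \<in> Poly_Mapping.keys (pd 2 f)" "m = Poly_Mapping.single 1 1 + n"
          by (auto simp: var_def)
        then have "n + Poly_Mapping.single 2 1 \<in> Poly_Mapping.keys f"
          by (auto simp: in_keys_iff lookup_pd)
        then have "Poly_Mapping.lookup (n + Poly_Mapping.single 2 1) 2 \<le> Suc d" using Suc.prems by blast
        then show ?thesis by (simp add: n lookup_add lookup_single)
      qed
      then show ?thesis using Suc.IH[OF gU False] by blast
    qed
  qed
  show "U = {0} \<or> U = VN N"
  proof (cases "U = {0}")
    case False
    then obtain f where f: "f \<in> U" "f \<noteq> 0"
      using pvs.subspace_0[OF subU] by blast
    have "\<forall>m\<in>Poly_Mapping.keys f. Poly_Mapping.lookup m 2 \<le> N"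
      using f UV by (force simp: VN_iff in_keys_iff)
    then have b0: "?b 0 \<in> U" using up f by blast
    have "?b q \<in> U" if "q \<le> N" for q
      using that
    proof (induction q)
      case 0 then show ?case using b0 by simp
    next
      case (Suc q)
      have "mon2 (N - q) q - Poly_Mapping.single 1 1 + Poly_Mapping.single 2 1 = mon2 (N - Suc q) (Suc q)"
        by (subst mon2_eta) (simp add: mon2_eq_iff lookup_add lookup_minus lookup_single)
      then have "act (E 2 1) (?b q) = pscale (of_nat (N - q)) (?b (Suc q))"
        by (simp add: act_E pd_single var_def mult_single add.commute pscale_def)
      then have *: "pscale (of_nat (N - q)) (?b (Suc q)) \<in> U"
        using clos[OF sl(2), of "?b q"] Suc by simp
      have nz: "of_nat (N - q) \<noteq> (0::complex)" using Suc.prems by simp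
      have "pscale (inverse (of_nat (N - q))) (pscale (of_nat (N - q)) (?b (Suc q))) \<in> U"
        using * by (rule pvs.subspace_scale[OF subU])
      then show ?case using nz by simp
    qed
    then have "pvs.span (?b ` {..N}) \<subseteq> U"
      using subU by (intro pvs.span_minimal) auto
    then show ?thesis using UV by (simp add: VN_basis(2))
  qed simp
qed


subsection \<open>Existence of the identification\<close>

text \<open>It is unique on \<^term>\<open>sl \<times> sl\<close>, since the four prescribed elements generate.\<close>

definition sl2_embed :: "nat \<Rightarrow> nat \<Rightarrow> complex^2^2 \<Rightarrow> complex^4^4" where
  "sl2_embed j k a = mscale (a $ 1 $ 1) (Astar k) +
     mscale ((a $ 1 $ 2 + a $ 2 $ 1) / 2) (A j) + mscale ((a $ 1 $ 2 - a $ 2 $ 1) / 2) (Astar k ** A j)"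


lemma lie_subalgebra_sl: "lie_subalgebra (sl :: (complex^'n^'n) set)"
proof -
  have "trace (mscale c X) = c * trace X" for c and X :: "complex^'n^'n"
    by (simp add: trace_def mscale_def sum_distrib_left)
  moreover have "trace (lie X Y) = 0" for X Y :: "complex^'n^'n"
    by (simp add: lie_def trace_sub trace_mul_sym[of X Y])
  moreover have "trace (0 :: complex^'n^'n) = 0"
    by (simp add: trace_def)
  ultimately show ?thesis
    by (simp add: lie_subalgebra_def sl_def trace_add)
qed

lemma lie_subalgebra_hull:
  assumes "S \<subseteq> sl" shows "lie_subalgebra (lie_subalgebra hull S)"
proof -
  have "lie_subalgebra hull S \<subseteq> sl" using assms lie_subalgebra_sl by (rule hull_minimal)
  then show ?thesis unfolding lie_subalgebra_def hull_def by auto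
qed

lemmas mat_simps = vec_eq_iff forall_4 forall_2 sum_4 sum_2 matrix_matrix_mult_def mscale_def lie_def
  A_def Astar_def E_def diag_def vector_def A2_def A2star_def sl2_embed_def

abbreviation "index_pairs \<equiv> {(1, 2), (2, 1), (1, 3), (3, 1), (2, 3), (3, 2 :: nat)}"

lemma sl2_embed_lie:
  assumes "(j, k) \<in> index_pairs" "a \<in> sl" "b \<in> sl"
  shows "sl2_embed j k (lie a b) = lie (sl2_embed j k a) (sl2_embed j k b)"
proof -
  have [simp]: "a $ 2 $ 2 = - a $ 1 $ 1" "b $ 2 $ 2 = - b $ 1 $ 1"
    using assms(2,3) by (auto simp: sl_def trace_def sum_2 eq_neg_iff_add_eq_0 add.commute)
  show ?thesis using assms(1)
    by (elim insertE emptyE; simp add: mat_simps; simp add: field_simps)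
qed

lemma sl2_embed_commute:
  assumes "(j, k) \<in> index_pairs"
  shows "lie (sl2_embed j k a) (sl2_embed k j b) = 0"
  using assms
  by (elim insertE emptyE; simp add: mat_simps; simp add: field_simps)

lemma sl2_embed_trace:
  assumes "(j, k) \<in> index_pairs"
  shows "trace ((sl2_embed j k a + sl2_embed k j b) ** Astar k) = 4 * a $ 1 $ 1"
    and "trace ((sl2_embed j k a + sl2_embed k j b) ** A j) = 2 * (a $ 1 $ 2 + a $ 2 $ 1)"
    and "trace ((sl2_embed j k a + sl2_embed k j b) ** (Astar k ** A j)) = - 2 * (a $ 1 $ 2 - a $ 2 $ 1)"
  using assms
  by (elim insertE emptyE; simp add: mat_simps trace_def; simp add: field_simps)+


lemma mscale_linear:
  "mscale c (X + Y) = mscale c X + mscale c Y" "mscale (c + d) X = mscale c X + mscale d X"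
  "mscale c (mscale d X) = mscale (c * d) X" "mscale 1 X = X" "mscale 0 X = 0"
  by (simp_all add: mscale_def vec_eq_iff algebra_simps)

lemma lie_bilinear:
  "lie (X + Y) Z = lie X Z + lie Y Z" "lie Z (X + Y) = lie Z X + lie Z Y"
  by (simp_all add: lie_def matrix_matrix_mult_def vec_eq_iff algebra_simps sum.distrib)

lemma lie_zero: "lie 0 X = 0" "lie X 0 = 0"
  by (simp_all add: lie_def)

lemma lie_swap: "lie X Y = 0 \<Longrightarrow> lie Y X = 0"
  by (simp add: lie_def)

lemma sl2_embed_linear:
  "sl2_embed j k (a + b) = sl2_embed j k a + sl2_embed j k b"
  "sl2_embed j k (mscale c a) = mscale c (sl2_embed j k a)"
  "sl2_embed j k 0 = 0"
  by (simp_all add: sl2_embed_def mscale_def vec_eq_iff algebra_simps add_divide_distrib diff_divide_distrib)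

lemma sl2_embed_gens: "sl2_embed j k A2 = A j" "sl2_embed j k A2star = Astar k"
  by (simp_all add: sl2_embed_def A2_def A2star_def diag_def mscale_linear)

lemma generator_sl: "A j \<in> sl" "Astar j \<in> sl"
  by (simp_all add: sl_def trace_def mat_simps)

lemma gens_sl2: "A2 \<in> sl" "A2star \<in> sl" "(0 :: complex^'n^'n) \<in> sl"
  by (simp_all add: sl_def trace_def A2_def A2star_def diag_def sum_2)

lemma half_lie:
  assumes "(j, k) \<in> index_pairs"
  shows "Astar k ** A j = mscale (1/2) (lie (Astar k) (A j))"
  using assms by (elim insertE emptyE; simp add: mat_simps)

theorem sl2_identification_exists:
  assumes ijk: "{i, j, k} = {1, 2, 3}"
  shows "\<exists>\<theta>. sl2_identification i j k \<theta>"
proof -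
  define \<theta> where "\<theta> = (\<lambda>(a, b). sl2_embed j k a + sl2_embed k j b)"
  have i: "{1, 2, 3} - {i} = {j, k}" and p: "(j, k) \<in> index_pairs"
  proof -
    have "card {i, j, k} = card {1, 2, 3 :: nat}" by (rule arg_cong[OF ijk])
    then have ne: "i \<noteq> j" "i \<noteq> k" "j \<noteq> k"
      by (auto simp: card_insert_if split: if_splits)
    then show "{1, 2, 3} - {i} = {j, k}" unfolding ijk[symmetric] by auto
    have "j \<in> {1, 2, 3}" "k \<in> {1, 2, 3}" unfolding ijk[symmetric] by simp_all
    then show "(j, k) \<in> index_pairs" using ne by (elim insertE emptyE) simp_all
  qed
  then have q: "(k, j) \<in> index_pairs" by auto
  have gen: "lie_sub i = lie_subalgebra hull {A j, Astar j, A k, Astar k}"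
    unfolding lie_sub_def i by (simp add: insert_commute)
  have sub: "lie_subalgebra (lie_sub i)"
    unfolding gen by (rule lie_subalgebra_hull) (auto simp: generator_sl)
  then have cl: "\<And>X Y. X \<in> lie_sub i \<Longrightarrow> Y \<in> lie_sub i \<Longrightarrow> X + Y \<in> lie_sub i"
    "\<And>X c. X \<in> lie_sub i \<Longrightarrow> mscale c X \<in> lie_sub i"
    "\<And>X Y. X \<in> lie_sub i \<Longrightarrow> Y \<in> lie_sub i \<Longrightarrow> lie X Y \<in> lie_sub i"
    by (auto simp: lie_subalgebra_def)
  have g: "A j \<in> lie_sub i" "Astar j \<in> lie_sub i" "A k \<in> lie_sub i" "Astar k \<in> lie_sub i"
    unfolding gen by (auto intro!: hull_inc)
  have into: "\<theta> (a, b) \<in> lie_sub i" for a b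
    unfolding \<theta>_def by (simp add: sl2_embed_def half_lie[OF p] half_lie[OF q] cl g)
  have add: "\<theta> (a + a', b + b') = \<theta> (a, b) + \<theta> (a', b')" for a a' b b'
    by (simp add: \<theta>_def sl2_embed_linear)
  have scale: "\<theta> (mscale c a, mscale c b) = mscale c (\<theta> (a, b))" for c a b
    by (simp add: \<theta>_def sl2_embed_linear mscale_linear)
  have lie: "\<theta> (lie a a', lie b b') = lie (\<theta> (a, b)) (\<theta> (a', b'))"
    if "a \<in> sl" "a' \<in> sl" "b \<in> sl" "b' \<in> sl" for a a' b b'
    by (simp add: \<theta>_def sl2_embed_lie[OF p that(1,2)] sl2_embed_lie[OF q that(3,4)]
        lie_bilinear sl2_embed_commute[OF p] sl2_embed_commute[OF q])
  have vals: "\<theta> (A2, 0) = A j" "\<theta> (A2star, 0) = Astar k" "\<theta> (0, A2) = A k" "\<theta> (0, A2star) = Astar j"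
    by (simp_all add: \<theta>_def sl2_embed_linear sl2_embed_gens)
  have inj: "inj_on \<theta> (sl \<times> sl)"
  proof (rule inj_onI)
    fix x y assume x: "x \<in> sl \<times> sl" and y: "y \<in> sl \<times> sl" and eq: "\<theta> x = \<theta> y"
    obtain a b a' b' where ab: "x = (a, b)" "y = (a', b')" by (cases x, cases y)
    have eq1: "sl2_embed j k a + sl2_embed k j b = sl2_embed j k a' + sl2_embed k j b'"
      using eq by (simp add: ab \<theta>_def)
    then have eq2: "sl2_embed k j b + sl2_embed j k a = sl2_embed k j b' + sl2_embed j k a'"
      by (simp add: add.commute)
    have t: "X $ 2 $ 2 = - X $ 1 $ 1" if "X \<in> sl" for X :: "complex^2^2"
      using that by (auto simp: sl_def trace_def sum_2 eq_neg_iff_add_eq_0 add.commute)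
    have ext: "X = Y" if "X \<in> sl" "Y \<in> sl" "4 * X $ 1 $ 1 = 4 * Y $ 1 $ 1"
      "2 * (X $ 1 $ 2 + X $ 2 $ 1) = 2 * (Y $ 1 $ 2 + Y $ 2 $ 1)"
      "- 2 * (X $ 1 $ 2 - X $ 2 $ 1) = - 2 * (Y $ 1 $ 2 - Y $ 2 $ 1)" for X Y :: "complex^2^2"
    proof -
      have "4 * X $ 1 $ 2 = 4 * Y $ 1 $ 2" "4 * X $ 2 $ 1 = 4 * Y $ 2 $ 1"
        using that(4,5) by algebra+
      then show ?thesis
        using that(3) t[OF that(1)] t[OF that(2)] by (simp add: vec_eq_iff forall_2)
    qed
    have m: "a \<in> sl" "b \<in> sl" "a' \<in> sl" "b' \<in> sl" using x y by (simp_all add: ab)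
    note ta = sl2_embed_trace[OF p, of a b, unfolded eq1 sl2_embed_trace[OF p]]
    note tb = sl2_embed_trace[OF q, of b a, unfolded eq2 sl2_embed_trace[OF q]]
    have "a = a'" by (rule ext[OF m(1,3) ta[symmetric]])
    moreover have "b = b'" by (rule ext[OF m(2,4) tb[symmetric]])
    ultimately show "x = y" by (simp add: ab)
  qed
  have "lie_subalgebra (\<theta> ` (sl \<times> sl))"
    unfolding lie_subalgebra_def
  proof (intro conjI ballI allI)
    have S: "lie_subalgebra (sl :: (complex^2^2) set)" by (rule lie_subalgebra_sl)
    show "\<theta> ` (sl \<times> sl) \<subseteq> sl"
      using into sub by (auto simp: lie_subalgebra_def)
    have "\<theta> (0, 0) = 0" by (simp add: \<theta>_def sl2_embed_linear)
    then show "0 \<in> \<theta> ` (sl \<times> sl)" using gens_sl2(3) by (metis SigmaI image_eqI)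
    fix X assume "X \<in> \<theta> ` (sl \<times> sl)"
    then obtain a b where X: "X = \<theta> (a, b)" "a \<in> sl" "b \<in> sl" by auto
    show "mscale c X \<in> \<theta> ` (sl \<times> sl)" for c
      using S X by (auto simp: lie_subalgebra_def scale[symmetric])
    fix Y assume "Y \<in> \<theta> ` (sl \<times> sl)"
    then obtain a' b' where Y: "Y = \<theta> (a', b')" "a' \<in> sl" "b' \<in> sl" by auto
    show "X + Y \<in> \<theta> ` (sl \<times> sl)"
      using S X Y by (auto simp: lie_subalgebra_def add[symmetric])
    show "lie X Y \<in> \<theta> ` (sl \<times> sl)"
      using S X Y by (auto simp: lie_subalgebra_def lie[symmetric])
  qed
  moreover have "{A j, Astar j, A k, Astar k} \<subseteq> \<theta> ` (sl \<times> sl)"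
    using gens_sl2 by (auto simp: vals[symmetric])
  ultimately have "lie_sub i \<subseteq> \<theta> ` (sl \<times> sl)"
    unfolding gen by (intro hull_minimal)
  then have "\<theta> ` (sl \<times> sl) = lie_sub i" using into by auto
  then have "sl2_identification i j k \<theta>"
    unfolding sl2_identification_def bij_betw_def
    using inj vals by (auto simp: add scale lie)
  then show ?thesis by blast
qed

end

(*
  Give P_1 the basis u_s \<otimes> v_t of C^2 \<otimes> C^2, arranged in a 2 by 2 grid in which R_i is
  multiplication by the determinant q. Write a polynomial in divided powers, so that its coefficients
  are m! times the usual ones. Then L_i f = 0 says that the coefficient of f at an exponent m is
  unchanged under exchanging one unit of each diagonal entry of m for one of each antidiagonal entry,
  i.e. that it depends only on the row and column sums of m. Reading a pair (row sums, column sums) as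
  a pair of binary monomials identifies Ker(L_i) \<inter> P_N with V_N \<otimes> V_N, and this is
  equivariant. As q is invariant under the Lie subalgebra, multiplying by a power of q gives (ii);
  (i) follows because raising and then lowering operators show that V_N \<otimes> V_N is irreducible.
  The decomposition rests on [L_i, R_i] = Euler + 2: on R_i^l (Ker(L_i) \<inter> P_N) the operator
  L_i R_i is a nonzero scalar, so that L_i maps P_(n+2) onto P_n by induction on n, and
  R_i L_i + sqrt(-1) Euler has pairwise distinct eigenvalues on the summands.
*)

theory Submission
  imports Defs
begin

section \<open>Divided power coefficients\<close>

abbreviation lk :: "('x \<Rightarrow>\<^sub>0 'y::zero) \<Rightarrow> 'x \<Rightarrow> 'y" where "lk \<equiv> Poly_Mapping.lookup"

definition unit_exp :: "'n \<Rightarrow> ('n \<Rightarrow>\<^sub>0 nat)" where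
  "unit_exp a = Poly_Mapping.single a 1"

lemma lookup_unit_exp [simp]: "lk (unit_exp a) b = (if b = a then 1 else 0)"
  by (auto simp: unit_exp_def lookup_single when_def)

definition total_degree :: "('n::finite \<Rightarrow>\<^sub>0 nat) \<Rightarrow> nat" where
  "total_degree m = (\<Sum>a\<in>UNIV. lk m a)"

definition mfact :: "('n::finite \<Rightarrow>\<^sub>0 nat) \<Rightarrow> complex" where
  "mfact m = (\<Prod>a\<in>UNIV. fact (lk m a))"

text \<open>In the basis of divided powers \<open>x^m / m!\<close> this is the coefficient of
  \<open>f\<close> at \<open>m\<close>. A partial derivative becomes a pure shift of the index
  (\<open>dcoeff_pd\<close>); numerical factors arise only from multiplication by a
  variable.\<close>

definition dcoeff :: "('n::finite) cpoly \<Rightarrow> ('n \<Rightarrow>\<^sub>0 nat) \<Rightarrow> complex" where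
  "dcoeff f m = mfact m * lk f m"

lemma total_degree_add: "total_degree (m + n) = total_degree m + total_degree n"
  by (simp add: total_degree_def lookup_add sum.distrib)

lemma total_degree_unit [simp]: "total_degree (unit_exp a) = 1"
  by (simp add: total_degree_def)

lemma lookup_le_total_degree: "lk m a \<le> total_degree m"
  unfolding total_degree_def by (rule member_le_sum) auto

lemma finite_total_degree_eq: "finite {m :: 'n::finite \<Rightarrow>\<^sub>0 nat. total_degree m = N}"
proof (rule finite_imageD)
  show "inj_on lk {m :: 'n \<Rightarrow>\<^sub>0 nat. total_degree m = N}"
    by (rule inj_onI) simp
  have "lk ` {m :: 'n \<Rightarrow>\<^sub>0 nat. total_degree m = N} \<subseteq> (\<Pi>\<^sub>E a\<in>UNIV. {..N})"
    by (auto intro: lookup_le_total_degree)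
  then show "finite (lk ` {m :: 'n \<Rightarrow>\<^sub>0 nat. total_degree m = N})"
    by (rule finite_subset) (simp add: finite_PiE)
qed

lemma homog_iff: "f \<in> homog N \<longleftrightarrow> (\<forall>m. lk f m \<noteq> 0 \<longrightarrow> total_degree m = N)"
  by (auto simp: homog_def in_keys_iff total_degree_def)

lemma minus_unit_add_unit: "lk m a \<noteq> 0 \<Longrightarrow> m - unit_exp a + unit_exp a = m"
  for m :: "'n \<Rightarrow>\<^sub>0 nat"
  by (rule poly_mapping_eqI) (auto simp: lookup_add lookup_minus)

text \<open>Subtraction of exponents truncates, so exponents without \<open>a\<close> are separated;
  they are not keys of a multiple of \<open>var a\<close>.\<close>

lemma lookup_var_mult_eq:
  "lk (var a * f) m = (if lk m a = 0 then 0 else lk f (m - unit_exp a))"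
proof (cases "lk m a = 0")
  case True
  have "m \<notin> Poly_Mapping.keys (var a * f)"
  proof
    assume "m \<in> Poly_Mapping.keys (var a * f)"
    then obtain n where "m = unit_exp a + n"
      using keys_mult[of "var a" f] by (auto simp: var_def unit_exp_def)
    with True show False by (simp add: lookup_add)
  qed
  with True show ?thesis by (simp add: in_keys_iff)
next
  case False
  with lookup_var_mult[of a f "m - unit_exp a", folded unit_exp_def] show ?thesis
    by (simp add: minus_unit_add_unit)
qed

lemma mfact_nonzero [simp]: "mfact m \<noteq> 0"
  by (simp add: mfact_def)

lemma mfact_add_unit: "mfact (m + unit_exp a) = of_nat (lk m a + 1) * mfact m"
proof -
  have "mfact (m + unit_exp a) =
      (\<Prod>b\<in>UNIV. (if b = a then of_nat (lk m a + 1) else 1) * fact (lk m b))"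
    unfolding mfact_def by (rule prod.cong) (auto simp: lookup_add)
  then show ?thesis by (simp add: prod.distrib mfact_def del: of_nat_add)
qed

lemma mfact_minus_unit: "lk m a \<noteq> 0 \<Longrightarrow> mfact m = of_nat (lk m a) * mfact (m - unit_exp a)"
  using mfact_add_unit[of "m - unit_exp a" a] minus_unit_add_unit[of m a]
  by (simp add: lookup_minus)

lemma dcoeff_eqI: "(\<And>m. dcoeff f m = dcoeff g m) \<Longrightarrow> f = g"
  by (rule poly_mapping_eqI) (simp add: dcoeff_def)

lemma dcoeff_linear:
  "dcoeff (f + g) m = dcoeff f m + dcoeff g m"
  "dcoeff (f - g) m = dcoeff f m - dcoeff g m"
  "dcoeff (pscale c f) m = c * dcoeff f m"
  "dcoeff 0 m = 0"
  by (simp_all add: dcoeff_def lookup_add lookup_minus algebra_simps)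

lemma dcoeff_sum: "dcoeff (\<Sum>x\<in>S. h x) m = (\<Sum>x\<in>S. dcoeff (h x) m)"
  by (simp add: dcoeff_def lookup_sum sum_distrib_left)

lemma dcoeff_pd: "dcoeff (pd b f) m = dcoeff f (m + unit_exp b)"
  by (simp only: dcoeff_def lookup_pd[folded unit_exp_def] mfact_add_unit ac_simps)

text \<open>The factor \<open>of_nat (lk m a)\<close> vanishes exactly where the subtraction
  truncates, so one formula covers all \<open>m\<close>.\<close>

lemma dcoeff_var_mult: "dcoeff (var a * f) m = of_nat (lk m a) * dcoeff f (m - unit_exp a)"
  by (cases "lk m a = 0") (simp_all add: dcoeff_def lookup_var_mult_eq mfact_minus_unit[of m a])

lemma dcoeff_act:
  "dcoeff (act X f) m =
     (\<Sum>a\<in>UNIV. \<Sum>b\<in>UNIV. X $ a $ b * of_nat (lk m a) * dcoeff f (m - unit_exp a + unit_exp b))"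
  by (simp add: act_def dcoeff_sum dcoeff_linear dcoeff_var_mult dcoeff_pd mult.assoc)

lemma pd_commute: "pd a (pd b f) = pd b (pd a f)" for f :: "('n::finite) cpoly"
  by (rule dcoeff_eqI) (simp add: dcoeff_pd ac_simps)

lemma pd_diff: "pd b (f - g) = pd b f - pd b g"
  by (rule poly_mapping_eqI) (simp add: lookup_pd lookup_minus algebra_simps)

lemma pd_zero [simp]: "pd b 0 = 0"
  by (simp add: pd_def)

text \<open>Rewrites scalars as constant polynomials, so that ring normalisation can treat them as
  factors.\<close>

lemma pscale_eq_mult: "pscale c f = Poly_Mapping.single 0 c * f" for f :: "('n::finite) cpoly"
  by (simp add: pscale_def mult_map_scale_conv_mult)

lemma pscale_of_nat: "pscale (of_nat k) f = of_nat k * f" for f :: "('n::finite) cpoly"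
proof -
  have "(of_nat k :: 'n cpoly) = Poly_Mapping.single 0 (of_nat k)"
    by (induction k) (simp_all add: single_add)
  then show ?thesis by (simp add: pscale_eq_mult)
qed

section \<open>Homogeneous polynomials under multiplication and differentiation\<close>

lemma homog_minus: "f \<in> homog N \<Longrightarrow> g \<in> homog N \<Longrightarrow> f - g \<in> homog N"
  using homog_subspace by (rule pvs.subspace_diff)

lemma homog_var_mult:
  assumes "f \<in> homog N" shows "var a * f \<in> homog (Suc N)"
  unfolding homog_iff
proof (intro allI impI)
  fix m assume "lk (var a * f) m \<noteq> 0"
  then have "lk m a \<noteq> 0" "total_degree (m - unit_exp a) = N"
    using assms by (auto simp: lookup_var_mult_eq homog_iff split: if_splits)
  then show "total_degree m = Suc N"
    using total_degree_add[of "m - unit_exp a" "unit_exp a"] minus_unit_add_unit[of m a] by simp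
qed

lemma homog_pd:
  assumes "f \<in> homog (Suc N)" shows "pd a f \<in> homog N"
  using assms by (force simp: homog_iff lookup_pd[folded unit_exp_def] total_degree_add)

lemma pd_homog_0: "f \<in> homog 0 \<Longrightarrow> pd a f = 0"
  by (rule poly_mapping_eqI) (force simp del: of_nat_Suc of_nat_add
      simp add: homog_iff lookup_pd[folded unit_exp_def] total_degree_add)

section \<open>Tensors of binary forms\<close>

type_synonym tens = "(2 \<Rightarrow>\<^sub>0 nat) \<times> (2 \<Rightarrow>\<^sub>0 nat) \<Rightarrow>\<^sub>0 complex"

text \<open>Divided powers in both factors, so that a pure tensor has as coefficient the product of
  two values of \<open>dcoeff\<close>.\<close>

definition tcoeff :: "tens \<Rightarrow> (2 \<Rightarrow>\<^sub>0 nat) \<Rightarrow> (2 \<Rightarrow>\<^sub>0 nat) \<Rightarrow> complex" where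
  "tcoeff t m n = mfact m * mfact n * lk t (m, n)"

lemma tcoeff_linear:
  "tcoeff (s + t) m n = tcoeff s m n + tcoeff t m n"
  "tcoeff (pscale c t) m n = c * tcoeff t m n"
  "tcoeff 0 m n = 0"
  by (simp_all add: tcoeff_def lookup_add algebra_simps)

lemma tcoeff_sum: "tcoeff (\<Sum>x\<in>S. h x) m n = (\<Sum>x\<in>S. tcoeff (h x) m n)"
  by (simp add: tcoeff_def lookup_sum sum_distrib_left)

lemma tcoeff_tensor: "tcoeff (tensor u v) m n = dcoeff u m * dcoeff v n"
  by (simp add: tcoeff_def dcoeff_def)

lemma tcoeff_eqI: "(\<And>m n. tcoeff s m n = tcoeff t m n) \<Longrightarrow> s = t"
  by (rule poly_mapping_eqI) (auto simp: tcoeff_def)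

lemma tensor_expand:
  "t = (\<Sum>p\<in>Poly_Mapping.keys t.
     pscale (lk t p) (tensor (Poly_Mapping.single (fst p) 1) (Poly_Mapping.single (snd p) 1)))"
proof -
  have "pscale (lk t p) (tensor (Poly_Mapping.single (fst p) 1) (Poly_Mapping.single (snd p) 1))
      = Poly_Mapping.single p (lk t p)" for p
    by (rule poly_mapping_eqI, cases p) (auto simp: lookup_single when_def split: if_splits)
  then show ?thesis by (simp only: pm_expand[symmetric])
qed

text \<open>Linearity in \<open>t\<close> reduces the formula to the tensors of monomials in
  \<open>tensor_expand\<close>, where it follows from \<open>tensor_act_tensor\<close> and
  \<open>dcoeff_act\<close>.\<close>

lemma tcoeff_tensor_act:
  "tcoeff (tensor_act (X, Y) t) m n =
     (\<Sum>a\<in>UNIV. \<Sum>b\<in>UNIV. X $ a $ b * of_nat (lk m a) * tcoeff t (m - unit_exp a + unit_exp b) n) +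
     (\<Sum>a\<in>UNIV. \<Sum>b\<in>UNIV. Y $ a $ b * of_nat (lk n a) * tcoeff t m (n - unit_exp a + unit_exp b))"
proof -
  let ?s = "\<lambda>p. tensor (Poly_Mapping.single (fst p) (1::complex)) (Poly_Mapping.single (snd p) (1::complex))"
  have t: "tcoeff t k l = (\<Sum>p\<in>Poly_Mapping.keys t. lk t p * tcoeff (?s p) k l)" for k l
    using arg_cong[OF tensor_expand[of t], of "\<lambda>t. tcoeff t k l"]
    by (simp only: tcoeff_sum tcoeff_linear)
  have swap: "(\<Sum>a\<in>UNIV. \<Sum>b\<in>UNIV. f a b * (\<Sum>p\<in>Poly_Mapping.keys t. lk t p * g a b p)) =
      (\<Sum>p\<in>Poly_Mapping.keys t. lk t p * (\<Sum>a\<in>UNIV. \<Sum>b\<in>UNIV. f a b * g a b p))"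
    for f :: "2 \<Rightarrow> 2 \<Rightarrow> complex" and g
    by (simp add: sum_2 sum_distrib_left sum.distrib distrib_left mult.left_commute)
  let ?U = "\<lambda>p. \<Sum>a\<in>UNIV. \<Sum>b\<in>UNIV. X $ a $ b * of_nat (lk m a) * tcoeff (?s p) (m - unit_exp a + unit_exp b) n"
  let ?V = "\<lambda>p. \<Sum>a\<in>UNIV. \<Sum>b\<in>UNIV. Y $ a $ b * of_nat (lk n a) * tcoeff (?s p) m (n - unit_exp a + unit_exp b)"
  have step: "tcoeff (tensor_act (X, Y) (?s p)) m n = ?U p + ?V p" for p
    unfolding tensor_act_tensor tcoeff_linear tcoeff_tensor dcoeff_act
    by (simp only: sum_distrib_left sum_distrib_right ac_simps)
  have "tcoeff (tensor_act (X, Y) t) m n =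
      (\<Sum>p\<in>Poly_Mapping.keys t. lk t p * tcoeff (tensor_act (X, Y) (?s p)) m n)"
    unfolding tensor_act_tensor
    by (simp add: tensor_act_def tcoeff_sum tcoeff_linear case_prod_beta)
  also have "\<dots> = (\<Sum>p\<in>Poly_Mapping.keys t. lk t p * ?U p) + (\<Sum>p\<in>Poly_Mapping.keys t. lk t p * ?V p)"
    by (simp add: step distrib_left sum.distrib)
  also have "\<dots> =
     (\<Sum>a\<in>UNIV. \<Sum>b\<in>UNIV. X $ a $ b * of_nat (lk m a) * tcoeff t (m - unit_exp a + unit_exp b) n) +
     (\<Sum>a\<in>UNIV. \<Sum>b\<in>UNIV. Y $ a $ b * of_nat (lk n a) * tcoeff t m (n - unit_exp a + unit_exp b))"
    by (simp only: t swap)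
  finally show ?thesis .
qed

text \<open>Turns membership in a span of pure tensors into a condition on supports, which is the
  form used later.\<close>

lemma tensor_space_VN_iff:
  "t \<in> tensor_space (VN N) (VN N) \<longleftrightarrow>
     (\<forall>m n. tcoeff t m n \<noteq> 0 \<longrightarrow> total_degree m = N \<and> total_degree n = N)"
proof
  assume "t \<in> tensor_space (VN N) (VN N)"
  then have "t \<in> pvs.span {tensor u v | u v. u \<in> VN N \<and> v \<in> VN N}"
    by (simp add: tensor_space_def)
  then show "\<forall>m n. tcoeff t m n \<noteq> 0 \<longrightarrow> total_degree m = N \<and> total_degree n = N"
  proof (induction rule: pvs.span_induct_alt)
    case base then show ?case by (simp add: tcoeff_linear)
  next
    case (step c x y)
    then show ?case
      by (auto simp: tcoeff_linear tcoeff_tensor VN_def homog_iff dcoeff_def)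
        (metis add_0 mult_eq_0_iff)+
  qed
next
  assume "\<forall>m n. tcoeff t m n \<noteq> 0 \<longrightarrow> total_degree m = N \<and> total_degree n = N"
  then have *: "fst p \<in> {m. total_degree m = N}" "snd p \<in> {m. total_degree m = N}"
    if "p \<in> Poly_Mapping.keys t" for p
    using that by (cases p; force simp: tcoeff_def in_keys_iff)+
  have "(\<Sum>p\<in>Poly_Mapping.keys t.
     pscale (lk t p) (tensor (Poly_Mapping.single (fst p) 1) (Poly_Mapping.single (snd p) 1)))
      \<in> tensor_space (VN N) (VN N)"
    unfolding tensor_space_def
  proof (intro pvs.span_sum pvs.span_scale pvs.span_base CollectI exI conjI)
    fix p assume p: "p \<in> Poly_Mapping.keys t"
    show "Poly_Mapping.single (fst p) 1 \<in> VN N" "Poly_Mapping.single (snd p) 1 \<in> VN N"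
      using *[OF p] by (auto simp: VN_def homog_iff lookup_single when_def)
  qed simp
  then show "t \<in> tensor_space (VN N) (VN N)"
    by (simp only: tensor_expand[symmetric])
qed

section \<open>Polynomials in a two by two grid of variables\<close>

text \<open>\<open>\<sigma> (s, t)\<close> is the variable identified with \<open>u\<^sub>s \<otimes> v\<^sub>t\<close>, where
  \<open>u\<close> and \<open>v\<close> are the bases of the two factors \<open>\<complex>\<^sup>2\<close>.\<close>

locale grid =
  fixes \<sigma> :: "2 \<times> 2 \<Rightarrow> 'n::finite"
  assumes bij: "bij \<sigma>"
begin

lemma grid_eq_iff [simp]: "\<sigma> p = \<sigma> q \<longleftrightarrow> p = q"
  using bij by (simp add: bij_def inj_eq)

lemma grid_cases:
  obtains s t where "v = \<sigma> (s, t)"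
  using bij by (metis bij_pointE surj_pair)

lemma sum_grid: "(\<Sum>v\<in>UNIV. f v) = (\<Sum>s\<in>UNIV. \<Sum>t\<in>UNIV. f (\<sigma> (s, t)))"
proof -
  have "(\<Sum>v\<in>UNIV. f v) = (\<Sum>p\<in>UNIV \<times> UNIV. f (\<sigma> p))"
    using bij by (simp add: sum.reindex_bij_betw[symmetric])
  then show ?thesis by (simp add: sum.cartesian_product)
qed

section \<open>Row and column sums of an exponent\<close>

definition row_sums :: "('n \<Rightarrow>\<^sub>0 nat) \<Rightarrow> (2 \<Rightarrow>\<^sub>0 nat)" where
  "row_sums m = Abs_poly_mapping (\<lambda>s. \<Sum>t\<in>UNIV. lk m (\<sigma> (s, t)))"

definition col_sums :: "('n \<Rightarrow>\<^sub>0 nat) \<Rightarrow> (2 \<Rightarrow>\<^sub>0 nat)" where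
  "col_sums m = Abs_poly_mapping (\<lambda>t. \<Sum>s\<in>UNIV. lk m (\<sigma> (s, t)))"

lemma lookup_row_sums: "lk (row_sums m) s = (\<Sum>t\<in>UNIV. lk m (\<sigma> (s, t)))"
  and lookup_col_sums: "lk (col_sums m) t = (\<Sum>s\<in>UNIV. lk m (\<sigma> (s, t)))"
  by (simp_all add: row_sums_def col_sums_def)

lemma row_sums_add: "row_sums (m + n) = row_sums m + row_sums n"
  and col_sums_add: "col_sums (m + n) = col_sums m + col_sums n"
  by (rule poly_mapping_eqI, simp add: lookup_row_sums lookup_col_sums lookup_add sum.distrib)+

lemma row_sums_unit [simp]: "row_sums (unit_exp (\<sigma> (s, t))) = unit_exp s"
  by (rule poly_mapping_eqI) (simp add: lookup_row_sums)

lemma col_sums_unit [simp]: "col_sums (unit_exp (\<sigma> (s, t))) = unit_exp t"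
  by (rule poly_mapping_eqI) (simp add: lookup_col_sums)

text \<open>At a zero entry truncation would leave \<open>m\<close> unchanged while the row sum
  could still drop, hence the hypothesis.\<close>

lemma margins_move:
  assumes "lk m (\<sigma> (s, t)) \<noteq> 0"
  shows "row_sums (m - unit_exp (\<sigma> (s, t)) + unit_exp (\<sigma> (s', t'))) = row_sums m - unit_exp s + unit_exp s'"
    and "col_sums (m - unit_exp (\<sigma> (s, t)) + unit_exp (\<sigma> (s', t'))) = col_sums m - unit_exp t + unit_exp t'"
proof -
  define n where "n = m - unit_exp (\<sigma> (s, t))"
  have m: "m = n + unit_exp (\<sigma> (s, t))"
    using minus_unit_add_unit[OF assms] by (simp add: n_def)
  show "row_sums (m - unit_exp (\<sigma> (s, t)) + unit_exp (\<sigma> (s', t'))) = row_sums m - unit_exp s + unit_exp s'"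
    "col_sums (m - unit_exp (\<sigma> (s, t)) + unit_exp (\<sigma> (s', t'))) = col_sums m - unit_exp t + unit_exp t'"
    unfolding m by (simp_all add: row_sums_add col_sums_add)
qed

lemma total_degree_row_sums: "total_degree (row_sums m) = total_degree m"
  and total_degree_col_sums: "total_degree (col_sums m) = total_degree m"
  by (simp_all add: total_degree_def lookup_row_sums lookup_col_sums sum_grid sum_2)

text \<open>The entry at \<open>(2, 2)\<close> is made as large as the margins allow, and the other
  three are then forced. Equality of the total degrees makes all the subtractions exact.\<close>

lemma margins_exist:
  assumes "total_degree a = total_degree b"
  obtains m where "row_sums m = a" "col_sums m = b"
proof -
  define h where "h = min (lk a 2) (lk b 2)"
  define e where "e = (\<lambda>(s :: 2, t :: 2). if s = 2 then if t = 2 then h else lk a 2 - h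
     else if t = 2 then lk b 2 - h else lk a 1 - (lk b 2 - h))"
  define m where "m = Abs_poly_mapping (e \<circ> inv \<sigma>)"
  have lm: "lk m (\<sigma> p) = e p" for p
    using bij by (simp add: m_def bij_is_inj)
  have "lk a 1 + lk a 2 = lk b 1 + lk b 2"
    using assms by (simp add: total_degree_def sum_2)
  then have "lk (row_sums m) s = lk a s" "lk (col_sums m) s = lk b s" for s
    using exhaust_2[of s] by (auto simp: lookup_row_sums lookup_col_sums sum_2 lm e_def h_def)
  then show ?thesis by (intro that[of m] poly_mapping_eqI)
qed

text \<open>A two by two table with prescribed margins is determined by its entry at
  \<open>(2, 2)\<close>, and the exchange in \<open>F\<close> changes that entry by one. So the
  induction runs over the difference \<open>d\<close> of these entries.\<close>

lemma margins_connected: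
  fixes F :: "('n \<Rightarrow>\<^sub>0 nat) \<Rightarrow> 'b"
  assumes F: "\<And>m. F (m + unit_exp (\<sigma> (1, 1)) + unit_exp (\<sigma> (2, 2))) =
      F (m + unit_exp (\<sigma> (1, 2)) + unit_exp (\<sigma> (2, 1)))"
    and "row_sums m = row_sums m'" "col_sums m = col_sums m'"
  shows "F m = F m'"
proof -
  have eq: "F m = F m'" if "row_sums m = row_sums m'" "col_sums m = col_sums m'"
    "lk m' (\<sigma> (2, 2)) = lk m (\<sigma> (2, 2)) + d" for d m m'
    using that
  proof (induction d arbitrary: m')
    case 0
    have r: "lk m (\<sigma> (s, 1)) + lk m (\<sigma> (s, 2)) = lk m' (\<sigma> (s, 1)) + lk m' (\<sigma> (s, 2))"
      and c: "lk m (\<sigma> (1, s)) + lk m (\<sigma> (2, s)) = lk m' (\<sigma> (1, s)) + lk m' (\<sigma> (2, s))" for s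
      using 0(1,2) by (metis lookup_row_sums sum_2, metis lookup_col_sums sum_2)
    have "lk m (\<sigma> p) = lk m' (\<sigma> p)" for p
      using r[of 1] r[of 2] c[of 1] c[of 2] 0(3) exhaust_2[of "fst p"] exhaust_2[of "snd p"]
      by (cases p) auto
    then have "m = m'" by (intro poly_mapping_eqI) (metis grid_cases)
    then show ?case by simp
  next
    case (Suc d)
    have r: "lk m (\<sigma> (s, 1)) + lk m (\<sigma> (s, 2)) = lk m' (\<sigma> (s, 1)) + lk m' (\<sigma> (s, 2))"
      and c: "lk m (\<sigma> (1, s)) + lk m (\<sigma> (2, s)) = lk m' (\<sigma> (1, s)) + lk m' (\<sigma> (2, s))" for s
      using Suc(2,3) by (metis lookup_row_sums sum_2, metis lookup_col_sums sum_2)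
    \<comment> \<open>The entry of \<open>m'\<close> at \<open>(2, 2)\<close> exceeds that of
      \<open>m\<close> by \<open>Suc d\<close>. Equal column sums make the entry at
      \<open>(1, 2)\<close> smaller by the same amount, and equal row sums then make the one at
      \<open>(1, 1)\<close> larger.\<close>
    have nz: "lk m' (\<sigma> (1, 1)) \<noteq> 0" "lk m' (\<sigma> (2, 2)) \<noteq> 0"
      using r[of 1] c[of 2] Suc(4) by auto
    define n where "n = m' - unit_exp (\<sigma> (1, 1)) - unit_exp (\<sigma> (2, 2))"
    have m': "m' = n + unit_exp (\<sigma> (1, 1)) + unit_exp (\<sigma> (2, 2))"
      using nz by (intro poly_mapping_eqI) (auto simp: n_def lookup_add lookup_minus)
    let ?n = "n + unit_exp (\<sigma> (1, 2)) + unit_exp (\<sigma> (2, 1))"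
    have "F m = F ?n"
    proof (rule Suc.IH)
      show "row_sums m = row_sums ?n" "col_sums m = col_sums ?n"
        unfolding Suc(2,3) m' by (simp_all add: row_sums_add col_sums_add ac_simps)
      show "lk ?n (\<sigma> (2, 2)) = lk m (\<sigma> (2, 2)) + d"
        using Suc(4) by (simp add: m' lookup_add)
    qed
    then show ?case by (simp add: m' F)
  qed
  show ?thesis
  proof (cases "lk m (\<sigma> (2, 2)) \<le> lk m' (\<sigma> (2, 2))")
    case True
    then show ?thesis
      using eq[of m m' "lk m' (\<sigma> (2, 2)) - lk m (\<sigma> (2, 2))"] assms(2,3) by simp
  next
    case False
    then show ?thesis
      using eq[of m' m "lk m (\<sigma> (2, 2)) - lk m' (\<sigma> (2, 2))"] assms(2,3) by simp
  qed
qed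

section \<open>Harmonic polynomials as tensors of binary forms\<close>

definition lap :: "'n cpoly \<Rightarrow> 'n cpoly" where
  "lap f = pd (\<sigma> (1, 1)) (pd (\<sigma> (2, 2)) f) - pd (\<sigma> (1, 2)) (pd (\<sigma> (2, 1)) f)"

lemma lap_eq_0_iff:
  "lap f = 0 \<longleftrightarrow> (\<forall>m. dcoeff f (m + unit_exp (\<sigma> (1, 1)) + unit_exp (\<sigma> (2, 2))) =
     dcoeff f (m + unit_exp (\<sigma> (1, 2)) + unit_exp (\<sigma> (2, 1))))"
proof -
  have "lap f = 0 \<longleftrightarrow> (\<forall>m. dcoeff (lap f) m = 0)"
    using dcoeff_eqI[of "lap f" 0] by (auto simp: dcoeff_linear)
  then show ?thesis by (simp add: lap_def dcoeff_linear dcoeff_pd)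
qed

definition harmonics :: "nat \<Rightarrow> 'n cpoly set" where
  "harmonics N = {f. lap f = 0} \<inter> homog N"

definition form :: "tens \<Rightarrow> 'n cpoly" where
  "form t = Abs_poly_mapping (\<lambda>m. tcoeff t (row_sums m) (col_sums m) / mfact m)"

text \<open>What has to be shown is that the support is finite, so that
  \<open>Abs_poly_mapping\<close> is meaningful: each key of \<open>t\<close> fixes the total degree
  of \<open>m\<close>, which leaves finitely many \<open>m\<close>.\<close>

lemma dcoeff_form: "dcoeff (form t) m = tcoeff t (row_sums m) (col_sums m)"
proof -
  have "{m. tcoeff t (row_sums m) (col_sums m) / mfact m \<noteq> 0} \<subseteq>
      (\<Union>p\<in>Poly_Mapping.keys t. {m. total_degree m = total_degree (fst p)})"
  proof
    fix m assume "m \<in> {m. tcoeff t (row_sums m) (col_sums m) / mfact m \<noteq> 0}"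
    then have "(row_sums m, col_sums m) \<in> Poly_Mapping.keys t"
      by (auto simp: tcoeff_def in_keys_iff)
    then show "m \<in> (\<Union>p\<in>Poly_Mapping.keys t. {m. total_degree m = total_degree (fst p)})"
      by (force simp: total_degree_row_sums)
  qed
  then have "finite {m. tcoeff t (row_sums m) (col_sums m) / mfact m \<noteq> 0}"
    by (rule finite_subset) (simp add: finite_total_degree_eq)
  then show ?thesis by (simp add: dcoeff_def form_def)
qed

lemma form_add: "form (s + t) = form s + form t"
  and form_pscale: "form (pscale c t) = pscale c (form t)"
  by (rule dcoeff_eqI, simp add: dcoeff_form dcoeff_linear tcoeff_linear)+

text \<open>Injective because all pairs of margins of equal degree occur
  (\<open>margins_exist\<close>) and tensors in the space vanish on the remaining pairs. Surjective
  because the coefficients of a harmonic polynomial depend only on margins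
  (\<open>margins_connected\<close>).\<close>

lemma form_bij: "bij_betw form (tensor_space (VN N) (VN N)) (harmonics N)"
  unfolding bij_betw_def
proof (intro conjI inj_onI equalityI subsetI)
  fix s t assume st: "s \<in> tensor_space (VN N) (VN N)" "t \<in> tensor_space (VN N) (VN N)"
    and eq: "form s = form t"
  show "s = t"
  proof (rule tcoeff_eqI)
    fix a b
    show "tcoeff s a b = tcoeff t a b"
    proof (cases "total_degree a = total_degree b")
      case True
      then obtain m where "row_sums m = a" "col_sums m = b" by (rule margins_exist)
      then show ?thesis using eq by (metis dcoeff_form)
    next
      case False
      then show ?thesis using st by (metis tensor_space_VN_iff)
    qed
  qed
next
  fix f assume "f \<in> form ` tensor_space (VN N) (VN N)"
  then obtain t where t: "t \<in> tensor_space (VN N) (VN N)" "f = form t" by auto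
  have "lap f = 0"
    by (simp add: lap_eq_0_iff t dcoeff_form row_sums_add col_sums_add ac_simps)
  moreover have "f \<in> homog N"
    unfolding homog_iff
  proof (intro allI impI)
    fix m assume "lk f m \<noteq> 0"
    then have "tcoeff t (row_sums m) (col_sums m) \<noteq> 0"
      using dcoeff_form[of t m] t(2) by (metis dcoeff_def mfact_nonzero mult_eq_0_iff)
    then show "total_degree m = N"
      using t(1) by (metis tensor_space_VN_iff total_degree_row_sums)
  qed
  ultimately show "f \<in> harmonics N" by (simp add: harmonics_def)
next
  fix f assume f: "f \<in> harmonics N"
  let ?S = "{a :: 2 \<Rightarrow>\<^sub>0 nat. total_degree a = N}"
  \<comment> \<open>\<open>SOME\<close> picks a table with margins \<open>a\<close> and
    \<open>b\<close>; the choice does not affect the coefficient of \<open>f\<close>. The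
    denominator cancels the factorials in \<open>tcoeff\<close>.\<close>
  define c where "c = (\<lambda>(a, b). if a \<in> ?S \<and> b \<in> ?S
    then dcoeff f (SOME m. row_sums m = a \<and> col_sums m = b) / (mfact a * mfact b) else 0)"
  define t where "t = Abs_poly_mapping c"
  have "finite {p. c p \<noteq> 0}"
  proof (rule finite_subset)
    show "{p. c p \<noteq> 0} \<subseteq> ?S \<times> ?S" by (auto simp: c_def split: if_splits)
  qed (simp add: finite_total_degree_eq)
  then have tc: "tcoeff t a b = (if a \<in> ?S \<and> b \<in> ?S
      then dcoeff f (SOME m. row_sums m = a \<and> col_sums m = b) else 0)" for a b
    by (simp add: tcoeff_def t_def c_def)
  have "t \<in> tensor_space (VN N) (VN N)"
    by (simp add: tensor_space_VN_iff tc)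
  moreover have "f = form t"
  proof (rule dcoeff_eqI)
    fix m
    show "dcoeff f m = dcoeff (form t) m"
    proof (cases "total_degree m = N")
      case True
      let ?m = "SOME m'. row_sums m' = row_sums m \<and> col_sums m' = col_sums m"
      have margins: "row_sums ?m = row_sums m \<and> col_sums ?m = col_sums m"
        by (rule someI[of _ m]) simp
      have "dcoeff f ?m = dcoeff f m"
      proof (rule margins_connected[where F = "dcoeff f"])
        show "dcoeff f (n + unit_exp (\<sigma> (1, 1)) + unit_exp (\<sigma> (2, 2))) =
            dcoeff f (n + unit_exp (\<sigma> (1, 2)) + unit_exp (\<sigma> (2, 1)))" for n
          using f by (simp add: harmonics_def lap_eq_0_iff)
      qed (use margins in simp_all)
      with True show ?thesis by (simp add: dcoeff_form tc total_degree_row_sums total_degree_col_sums)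
    next
      case False
      then have "dcoeff f m = 0" using f by (auto simp: harmonics_def homog_iff dcoeff_def)
      with False show ?thesis by (simp add: dcoeff_form tc total_degree_row_sums)
    qed
  qed
  ultimately show "f \<in> form ` tensor_space (VN N) (VN N)" by blast
qed

text \<open>\<open>Z\<close> is the matrix of \<open>X \<otimes> 1 + 1 \<otimes> Y\<close>.\<close>

definition kronecker_sum :: "complex^2^2 \<Rightarrow> complex^2^2 \<Rightarrow> complex^'n^'n \<Rightarrow> bool" where
  "kronecker_sum X Y Z \<longleftrightarrow> (\<forall>s t s' t'. Z $ \<sigma> (s, t) $ \<sigma> (s', t') =
     (if t = t' then X $ s $ s' else 0) + (if s = s' then Y $ t $ t' else 0))"

text \<open>The action moves one unit between cells of \<open>m\<close>. The part from
  \<open>X\<close> keeps the column and so changes only row sums; the weights of the cells in row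
  \<open>s\<close> add up to \<open>lk (row_sums m) s\<close>, the weight in
  \<open>tcoeff_tensor_act\<close>. The part from \<open>Y\<close> is symmetric.\<close>

lemma form_tensor_act:
  assumes "kronecker_sum X Y Z"
  shows "form (tensor_act (X, Y) t) = act Z (form t)"
proof (rule dcoeff_eqI)
  fix m
  let ?r = "\<lambda>s s'. row_sums m - unit_exp s + unit_exp s'"
  let ?c = "\<lambda>t t'. col_sums m - unit_exp t + unit_exp t'"
  have move: "of_nat (lk m (\<sigma> (s, t'))) * dcoeff (form t) (m - unit_exp (\<sigma> (s, t')) + unit_exp (\<sigma> (s', t'')))
      = of_nat (lk m (\<sigma> (s, t'))) * tcoeff t (?r s s') (?c t' t'')" for s s' t' t''
    by (cases "lk m (\<sigma> (s, t')) = 0") (simp_all add: dcoeff_form margins_move)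
  have pos: "lk (row_sums m) s \<noteq> 0" "lk (col_sums m) t' \<noteq> 0" if "lk m (\<sigma> (s, t')) \<noteq> 0" for s t'
    using that unfolding lookup_row_sums lookup_col_sums by (subst sum_eq_0_iff; auto)+
  \<comment> \<open>A unit that returns to its own row or column does not change the sums, provided
    there was one to take.\<close>
  have same: "of_nat (lk m (\<sigma> (s, t'))) * tcoeff t (?r s s) b = of_nat (lk m (\<sigma> (s, t'))) * tcoeff t (row_sums m) b"
    "of_nat (lk m (\<sigma> (s, t'))) * tcoeff t a (?c t' t') = of_nat (lk m (\<sigma> (s, t'))) * tcoeff t a (col_sums m)" for s t' a b
    using minus_unit_add_unit[of "row_sums m" s] minus_unit_add_unit[of "col_sums m" t'] pos[of s t']
    by (cases "lk m (\<sigma> (s, t')) = 0"; simp)+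
  have Z: "Z $ \<sigma> (s, t) $ \<sigma> (s', t') =
     (if t = t' then X $ s $ s' else 0) + (if s = s' then Y $ t $ t' else 0)" for s t s' t'
    using assms by (simp add: kronecker_sum_def)
  have "dcoeff (act Z (form t)) m = (\<Sum>s\<in>UNIV. \<Sum>t1\<in>UNIV. \<Sum>s'\<in>UNIV. \<Sum>t'\<in>UNIV.
      (if t1 = t' then X $ s $ s' * (of_nat (lk m (\<sigma> (s, t1))) * tcoeff t (?r s s') (col_sums m)) else 0) +
      (if s = s' then Y $ t1 $ t' * (of_nat (lk m (\<sigma> (s, t1))) * tcoeff t (row_sums m) (?c t1 t')) else 0))"
    unfolding dcoeff_act sum_grid mult.assoc move Z
    by (intro sum.cong refl) (auto simp: distrib_right same)
  also have "\<dots> = dcoeff (form (tensor_act (X, Y) t)) m"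
    unfolding dcoeff_form tcoeff_tensor_act lookup_row_sums lookup_col_sums
    by (simp add: sum_2 algebra_simps)
  finally show "dcoeff (form (tensor_act (X, Y) t)) m = dcoeff (act Z (form t)) m" by simp
qed

section \<open>The invariant quadric and the Euler operator\<close>

definition quad :: "'n cpoly" where
  "quad = var (\<sigma> (1, 1)) * var (\<sigma> (2, 2)) - var (\<sigma> (1, 2)) * var (\<sigma> (2, 1))"

text \<open>The derivation scales the determinant by the sum of the traces of \<open>X\<close> and
  \<open>Y\<close>, which is zero.\<close>

lemma act_quad:
  assumes "kronecker_sum X Y Z" "X \<in> sl" "Y \<in> sl"
  shows "act Z quad = 0"
proof -
  have tr: "X $ 2 $ 2 = - X $ 1 $ 1" "Y $ 2 $ 2 = - Y $ 1 $ 1"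
    using assms(2,3) by (auto simp: sl_def trace_def sum_2 eq_neg_iff_add_eq_0 add.commute)
  have Z: "Z $ \<sigma> (s, t) $ \<sigma> (s', t') =
     (if t = t' then X $ s $ s' else 0) + (if s = s' then Y $ t $ t' else 0)" for s t s' t'
    using assms(1) by (simp add: kronecker_sum_def)
  have diff: "act Z (f - g) = act Z f - act Z g" for f g
    using act_add[of Z "f - g" g] by simp
  have "act Z quad = pscale (X $ 1 $ 1 + Y $ 1 $ 1 + X $ 2 $ 2 + Y $ 2 $ 2) quad"
    unfolding quad_def
    by (simp add: diff act_derivation act_var sum_grid sum_2 Z pscale_eq_mult single_add algebra_simps)
  then show ?thesis by (simp add: tr)
qed

lemma act_quad_power_mult:
  assumes "kronecker_sum X Y Z" "X \<in> sl" "Y \<in> sl"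
  shows "act Z (quad ^ l * f) = quad ^ l * act Z f"
proof (induction l)
  case (Suc l)
  then show ?case
    by (simp add: act_derivation act_quad[OF assms] mult.assoc)
qed simp

definition euler :: "'n cpoly \<Rightarrow> 'n cpoly" where
  "euler f = (\<Sum>v\<in>UNIV. var v * pd v f)"

lemma euler_homog:
  assumes "f \<in> homog N" shows "euler f = pscale (of_nat N) f"
proof (rule poly_mapping_eqI)
  fix m
  have "lk (var v * pd v f) m = of_nat (lk m v) * lk f m" for v
    by (auto simp: lookup_var_mult_eq lookup_pd[folded unit_exp_def] minus_unit_add_unit lookup_minus)
  then have "lk (euler f) m = of_nat (total_degree m) * lk f m"
    by (simp add: euler_def lookup_sum total_degree_def sum_distrib_right)
  then show "lk (euler f) m = lk (pscale (of_nat N) f) m"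
    using assms by (cases "lk f m = 0") (auto simp: homog_iff)
qed

text \<open>In the product rule the mixed first order terms add up to \<open>euler f\<close>, and
  the constant 2 is \<open>lap quad\<close>.\<close>

lemma lap_quad: "lap (quad * f) = quad * lap f + euler f + 2 * f"
  unfolding lap_def quad_def euler_def sum_grid sum_2
  by (simp add: pd_mult pd_diff pd_add pd_var algebra_simps)

end

section \<open>Sums of eigenspaces\<close>

text \<open>Applying \<open>Z\<close> minus the scalar \<open>e j\<close> to the relation removes
  the term of index \<open>j\<close> and multiplies each other term by the nonzero
  \<open>e k - e j\<close>; the induction hypothesis applies to these rescaled eigenvectors.\<close>

lemma eigenvectors_sum_eq_0:
  fixes Z :: "('x \<Rightarrow>\<^sub>0 complex) \<Rightarrow> ('x \<Rightarrow>\<^sub>0 complex)"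
  assumes "finite K"
    and add: "\<And>f g. Z (f + g) = Z f + Z g" and scale: "\<And>c f. Z (pscale c f) = pscale c (Z f)"
    and eig: "\<And>k. k \<in> K \<Longrightarrow> Z (g k) = pscale (e k) (g k)" and "inj_on e K"
    and "(\<Sum>k\<in>K. g k) = 0"
  shows "\<forall>k\<in>K. g k = 0"
  using assms(1,4-6)
proof (induction K arbitrary: g rule: finite_induct)
  case (insert j K)
  have Zsum: "Z (sum h S) = (\<Sum>k\<in>S. Z (h k))" for h and S :: "'a set"
  proof -
    have "Z 0 = 0" using add[of 0 0] by simp
    then show ?thesis by (induct S rule: infinite_finite_induct) (simp_all add: add)
  qed
  have "(\<Sum>k\<in>insert j K. pscale (e k - e j) (g k)) =
      (\<Sum>k\<in>insert j K. Z (g k)) - pscale (e j) (\<Sum>k\<in>insert j K. g k)"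
    using insert.prems(1)
    by (simp add: pvs.scale_left_diff_distrib sum_subtractf pvs.scale_sum_right del: sum.insert)
  also have "\<dots> = 0"
    using insert.prems(3) Zsum[of g "insert j K"] add[of 0 0] by simp
  finally have "(\<Sum>k\<in>K. pscale (e k - e j) (g k)) = 0"
    using insert.hyps by simp
  then have "\<forall>k\<in>K. pscale (e k - e j) (g k) = 0"
    using insert.prems by (intro insert.IH) (auto simp: scale mult.commute inj_on_def)
  moreover have "e k \<noteq> e j" if "k \<in> K" for k
    using that insert.prems(2) insert.hyps(2) by (auto simp: inj_on_def)
  ultimately have K: "\<forall>k\<in>K. g k = 0" by simp
  then show ?case using insert.prems(3) insert.hyps by simp
qed simp

lemma span_UN_decompose:
  assumes "\<And>k. pvs.subspace (W k)" and "f \<in> pvs.span (\<Union>k. W k)"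
  shows "\<exists>g. (\<forall>k. g k \<in> W k) \<and> finite {k. g k \<noteq> 0} \<and> f = (\<Sum>k | g k \<noteq> 0. g k)"
  using assms(2)
proof (induction rule: pvs.span_induct_alt)
  case base
  show ?case by (rule exI[of _ "\<lambda>_. 0"]) (simp add: pvs.subspace_0[OF assms(1)])
next
  case (step c x y)
  then obtain k g where k: "x \<in> W k" and g: "\<forall>k. g k \<in> W k" "finite {k. g k \<noteq> 0}" "y = (\<Sum>k | g k \<noteq> 0. g k)"
    by blast
  \<comment> \<open>Adding \<open>pscale c x\<close> may create or cancel the term at
    \<open>k\<close>, so sums are compared over a common finite superset of the supports.\<close>
  let ?K = "insert k {k. g k \<noteq> 0}"
  let ?h = "g(k := pscale c x + g k)"
  have fin: "finite ?K" using g(2) by simp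
  have sub: "{k. ?h k \<noteq> 0} \<subseteq> ?K" by auto
  have "(\<Sum>k | ?h k \<noteq> 0. ?h k) = (\<Sum>k\<in>?K. ?h k)"
    using fin sub by (intro sum.mono_neutral_left) auto
  also have "\<dots> = pscale c x + g k + (\<Sum>k\<in>?K - {k}. g k)"
    using fin by (simp add: sum.insert_remove)
  also have "\<dots> = pscale c x + (\<Sum>k\<in>?K. g k)"
    using fin by (simp add: sum.insert_remove add.assoc)
  also have "(\<Sum>k\<in>?K. g k) = y"
    unfolding g(3) using fin by (intro sum.mono_neutral_right) auto
  finally have "pscale c x + y = (\<Sum>k | ?h k \<noteq> 0. ?h k)" by simp
  moreover have "\<forall>k. ?h k \<in> W k"
    using g(1) k assms(1) by (auto intro: pvs.subspace_add pvs.subspace_scale)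
  ultimately show ?case using finite_subset[OF sub fin] by blast
qed

text \<open>Existence of a decomposition is the spanning hypothesis. For uniqueness, the differences
  of the terms of two decompositions are eigenvectors with sum zero.\<close>

lemma internal_direct_sum_eigenspaces:
  assumes sub: "\<And>k. pvs.subspace (W k)" and span: "pvs.span (\<Union>k. W k) = UNIV"
    and add: "\<And>f g. Z (f + g) = Z f + Z g" and scale: "\<And>c f. Z (pscale c f) = pscale c (Z f)"
    and eig: "\<And>k f. f \<in> W k \<Longrightarrow> Z f = pscale (e k) f" and "inj e"
  shows "internal_direct_sum W UNIV"
  unfolding internal_direct_sum_def
proof (intro conjI allI ballI ex_ex1I)
  fix f
  show "\<exists>g. (\<forall>k. g k \<in> W k) \<and> finite {k. g k \<noteq> 0} \<and> f = (\<Sum>k | g k \<noteq> 0. g k)"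
    using span by (intro span_UN_decompose sub) simp
next
  fix f g h
  assume g: "(\<forall>k. g k \<in> W k) \<and> finite {k. g k \<noteq> 0} \<and> f = (\<Sum>k | g k \<noteq> 0. g k)"
    and h: "(\<forall>k. h k \<in> W k) \<and> finite {k. h k \<noteq> 0} \<and> f = (\<Sum>k | h k \<noteq> 0. h k)"
  let ?K = "{k. g k \<noteq> 0} \<union> {k. h k \<noteq> 0}"
  have fin: "finite ?K" using g h by simp
  have "(\<Sum>k\<in>?K. g k) = (\<Sum>k | g k \<noteq> 0. g k)" "(\<Sum>k\<in>?K. h k) = (\<Sum>k | h k \<noteq> 0. h k)"
    using fin by (intro sum.mono_neutral_right; auto)+
  then have sum0: "(\<Sum>k\<in>?K. g k - h k) = 0" using g h by (simp add: sum_subtractf)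
  have eig0: "Z (g k - h k) = pscale (e k) (g k - h k)" for k
    using g h by (intro eig[of _ k] pvs.subspace_diff sub) auto
  have "inj_on e ?K" using \<open>inj e\<close> by (rule inj_on_subset) simp
  note eq = eigenvectors_sum_eq_0[where Z = Z, OF fin add scale eig0 this sum0]
  show "g = h"
  proof
    fix k show "g k = h k"
      using bspec[OF eq, of k] by (cases "k \<in> ?K") auto
  qed
qed (auto simp: sub)

section \<open>Irreducibility of the tensor square\<close>

lemma tcoeff_tensor_act_E:
  "tcoeff (tensor_act (E a b, 0) t) m n = of_nat (lk m a) * tcoeff t (m - unit_exp a + unit_exp b) n"
  "tcoeff (tensor_act (0, E a b) t) m n = of_nat (lk n a) * tcoeff t m (n - unit_exp a + unit_exp b)"
proof -
  have "(\<Sum>c\<in>UNIV. \<Sum>d\<in>UNIV. E a b $ c $ d * of_nat (lk k c) * F c d) = of_nat (lk k a) * F a b"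
    for F :: "2 \<Rightarrow> 2 \<Rightarrow> complex" and k
  proof -
    have "(\<Sum>c\<in>UNIV. \<Sum>d\<in>UNIV. E a b $ c $ d * of_nat (lk k c) * F c d) =
       (\<Sum>c\<in>UNIV. \<Sum>d\<in>UNIV. if d = b then (if c = a then of_nat (lk k a) * F a b else 0) else 0)"
      by (intro sum.cong refl) (simp add: E_def)
    then show ?thesis by simp
  qed
  then show "tcoeff (tensor_act (E a b, 0) t) m n = of_nat (lk m a) * tcoeff t (m - unit_exp a + unit_exp b) n"
    "tcoeff (tensor_act (0, E a b) t) m n = of_nat (lk n a) * tcoeff t m (n - unit_exp a + unit_exp b)"
    by (simp_all add: tcoeff_tensor_act)
qed

lemma move_back: "lk m b \<noteq> 0 \<Longrightarrow> m - unit_exp b + unit_exp a - unit_exp a + unit_exp b = m"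
  for m :: "'n \<Rightarrow>\<^sub>0 nat"
  by (simp add: minus_unit_add_unit)

lemma total_degree_move:
  "lk m a \<noteq> 0 \<Longrightarrow> total_degree (m - unit_exp a + unit_exp b) = total_degree m"
  by (metis minus_unit_add_unit total_degree_add total_degree_unit)

text \<open>The action moves units within one exponent, which preserves its total degree.\<close>

lemma tensor_space_submodule: "is_submodule (sl \<times> sl) tensor_act (tensor_space (VN N) (VN N))"
  unfolding is_submodule_def
proof (intro conjI ballI)
  show "pvs.subspace (tensor_space (VN N) (VN N))"
    by (simp add: tensor_space_def)
  fix p :: "(complex^2^2) \<times> (complex^2^2)" and t assume t: "t \<in> tensor_space (VN N) (VN N)"
  obtain X Y where p: "p = (X, Y)" by (cases p)
  have "tcoeff (tensor_act (X, Y) t) m n = 0" if *: "\<not> (total_degree m = N \<and> total_degree n = N)" for m n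
  proof -
    have zero: "of_nat (lk m a) * tcoeff t (m - unit_exp a + unit_exp b) n = 0"
      "of_nat (lk n a) * tcoeff t m (n - unit_exp a + unit_exp b) = 0" for a b
      using t * total_degree_move[of m a b] total_degree_move[of n a b]
      unfolding tensor_space_VN_iff by (metis mult_eq_0_iff of_nat_eq_0_iff)+
    show ?thesis
      by (simp only: tcoeff_tensor_act mult.assoc zero mult_zero_right sum.neutral_const add_0)
  qed
  then show "tensor_act p t \<in> tensor_space (VN N) (VN N)"
    unfolding tensor_space_VN_iff p by blast
qed

text \<open>A nonzero submodule contains a highest weight vector, reached by \<open>E 1 2\<close> in
  either factor; applying \<open>E 2 1\<close> in either factor to it then reaches every tensor of
  monomials up to a scalar.\<close>

theorem tensor_space_irreducible:
  "is_irreducible_submodule (sl \<times> sl) tensor_act (tensor_space (VN N) (VN N))"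
  unfolding is_irreducible_submodule_def
proof (intro conjI allI impI)
  let ?V = "tensor_space (VN N) (VN N)"
  have supported: "Poly_Mapping.single (m, n) c \<in> ?V" if "total_degree m = N" "total_degree n = N" for m n c
    using that by (auto simp: tensor_space_VN_iff tcoeff_def lookup_single when_def)
  have deg: "total_degree (mon2 N 0) = N"
    by (simp add: total_degree_def sum_2)
  have "Poly_Mapping.single (mon2 N 0, mon2 N 0) 1 \<noteq> (0 :: tens)"
    by (metis lookup_single_eq lookup_zero zero_neq_one)
  then show "?V \<noteq> {0}" using supported[OF deg deg, of 1] by auto
  show "is_submodule (sl \<times> sl) tensor_act ?V" by (rule tensor_space_submodule)
  fix U assume U: "is_submodule (sl \<times> sl) tensor_act U \<and> U \<subseteq> ?V"
  then have sub: "pvs.subspace U" and UV: "U \<subseteq> ?V" by (auto simp: is_submodule_def)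
  have sl: "E 1 2 \<in> (sl :: (complex^2^2) set)" "E 2 1 \<in> (sl :: (complex^2^2) set)"
    by (simp_all add: sl_def trace_def E_def sum_2)
  have clos: "tensor_act (X, Y) t \<in> U" if "X \<in> sl" "Y \<in> sl" "t \<in> U" for X Y t
    using U that by (auto simp: is_submodule_def)
  have clos: "tensor_act (E 1 2, 0) t \<in> U" "tensor_act (E 2 1, 0) t \<in> U"
    "tensor_act (0, E 1 2) t \<in> U" "tensor_act (0, E 2 1) t \<in> U" if "t \<in> U" for t
    using that by (auto intro!: clos sl gens_sl2(3))
  let ?supp = "\<lambda>t. {p. tcoeff t (fst p) (snd p) \<noteq> 0}"
  \<comment> \<open>Induction on a bound for the joint exponent of the second variables. A raising
    operator decreases the bound; if both annihilate \<open>t\<close>, that exponent is already zero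
    throughout the support.\<close>
  have top: "\<exists>t\<in>U. t \<noteq> 0 \<and> (\<forall>m n. tcoeff t m n \<noteq> 0 \<longrightarrow> lk m 2 = 0 \<and> lk n 2 = 0)"
    if "t \<in> U" "t \<noteq> 0" "\<forall>m n. tcoeff t m n \<noteq> 0 \<longrightarrow> lk m 2 + lk n 2 \<le> d" for t d
    using that
  proof (induction d arbitrary: t)
    case 0
    then show ?case by fastforce
  next
    case (Suc d)
    consider "tensor_act (E 1 2, 0) t \<noteq> 0" | "tensor_act (0, E 1 2) t \<noteq> 0"
      | "tensor_act (E 1 2, 0) t = 0" "tensor_act (0, E 1 2) t = 0" by blast
    then show ?case
    proof cases
      case 1
      have "lk m 2 + lk n 2 \<le> d" if "tcoeff (tensor_act (E 1 2, 0) t) m n \<noteq> 0" for m n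
      proof -
        have "tcoeff t (m - unit_exp 1 + unit_exp 2) n \<noteq> 0"
          using that by (simp add: tcoeff_tensor_act_E)
        then have "lk (m - unit_exp 1 + unit_exp 2) 2 + lk n 2 \<le> Suc d" using Suc.prems(3) by blast
        then show ?thesis by (simp add: lookup_add lookup_minus)
      qed
      then show ?thesis using Suc.IH[OF clos(1)[OF Suc.prems(1)] 1] by blast
    next
      case 2
      have "lk m 2 + lk n 2 \<le> d" if "tcoeff (tensor_act (0, E 1 2) t) m n \<noteq> 0" for m n
      proof -
        have "tcoeff t m (n - unit_exp 1 + unit_exp 2) \<noteq> 0"
          using that by (simp add: tcoeff_tensor_act_E)
        then have "lk m 2 + lk (n - unit_exp 1 + unit_exp 2) 2 \<le> Suc d" using Suc.prems(3) by blast
        then show ?thesis by (simp add: lookup_add lookup_minus)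
      qed
      then show ?thesis using Suc.IH[OF clos(3)[OF Suc.prems(1)] 2] by blast
    next
      case 3
      \<comment> \<open>If \<open>m\<close> contained the second variable, the vanishing
        \<open>tensor_act (E 1 2, 0) t\<close> would have, at \<open>m\<close> with one unit shifted
        to the first variable, the coefficient \<open>tcoeff t m n\<close> times a positive
        number.\<close>
      have "lk m 2 = 0 \<and> lk n 2 = 0" if nz: "tcoeff t m n \<noteq> 0" for m n
      proof (intro conjI; rule ccontr)
        assume *: "lk m 2 \<noteq> 0"
        have "of_nat (lk (m - unit_exp 2 + unit_exp 1) 1) * tcoeff t m n = 0"
          using tcoeff_tensor_act_E(1)[of 1 2 t "m - unit_exp 2 + unit_exp 1" n]
          unfolding 3 move_back[OF *] by (simp add: tcoeff_linear)
        then have "lk (m - unit_exp 2 + unit_exp 1) 1 = 0"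
          using nz by (simp only: mult_eq_0_iff of_nat_eq_0_iff) simp
        then show False by (simp add: lookup_add)
      next
        assume *: "lk n 2 \<noteq> 0"
        have "of_nat (lk (n - unit_exp 2 + unit_exp 1) 1) * tcoeff t m n = 0"
          using tcoeff_tensor_act_E(2)[of 1 2 t m "n - unit_exp 2 + unit_exp 1"]
          unfolding 3 move_back[OF *] by (simp add: tcoeff_linear)
        then have "lk (n - unit_exp 2 + unit_exp 1) 1 = 0"
          using nz by (simp only: mult_eq_0_iff of_nat_eq_0_iff) simp
        then show False by (simp add: lookup_add)
      qed
      then show ?thesis using Suc.prems by blast
    qed
  qed
  show "U = {0} \<or> U = ?V"
  proof (cases "U = {0}")
    case False
    then obtain t where t: "t \<in> U" "t \<noteq> 0" using pvs.subspace_0[OF sub] by blast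
    have "lk m 2 + lk n 2 \<le> 2 * N" if "tcoeff t m n \<noteq> 0" for m n
    proof -
      have "total_degree m = N" "total_degree n = N"
        using that t(1) UV by (auto simp: tensor_space_VN_iff)
      then show ?thesis
        using lookup_le_total_degree[of m 2] lookup_le_total_degree[of n 2] by simp
    qed
    then obtain h where h: "h \<in> U" "h \<noteq> 0"
      "\<And>m n. tcoeff h m n \<noteq> 0 \<Longrightarrow> lk m 2 = 0 \<and> lk n 2 = 0"
      using top[OF t] by blast
    have "m = mon2 N 0 \<and> n = mon2 N 0" if nz: "tcoeff h m n \<noteq> 0" for m n
    proof -
      have "total_degree m = N" "total_degree n = N"
        using nz h(1) UV by (auto simp: tensor_space_VN_iff)
      then show ?thesis
        using h(3)[OF nz] mon2_eta[of m] mon2_eta[of n] by (simp add: total_degree_def sum_2)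
    qed
    moreover obtain m n where "tcoeff h m n \<noteq> 0"
      using h(2) tcoeff_eqI[of h 0] by (auto simp: tcoeff_linear)
    ultimately have h_supp: "?supp h = {(mon2 N 0, mon2 N 0)}" by fastforce
    \<comment> \<open>Only supports are tracked: \<open>U\<close> contains an element supported
      exactly at \<open>(m, n)\<close>, whatever its scalar.\<close>
    have all: "\<exists>t\<in>U. ?supp t = {(m, n)}"
      if "total_degree m = N" "total_degree n = N" "lk m 2 + lk n 2 = d" for m n d
      using that
    proof (induction d arbitrary: m n)
      case 0
      then have "m = mon2 N 0" "n = mon2 N 0"
        using mon2_eta[of m] mon2_eta[of n] by (simp_all add: total_degree_def sum_2)
      then show ?case using h(1) h_supp by blast
    next
      case (Suc d)
      show ?case
      proof (cases "lk m 2 = 0")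
        case False
        let ?m = "m - unit_exp 2 + unit_exp 1"
        have "total_degree ?m = N" using total_degree_move[OF False] Suc.prems by simp
        moreover have "lk ?m 2 + lk n 2 = d" using Suc.prems(3) False by (simp add: lookup_add lookup_minus)
        ultimately obtain t where t: "t \<in> U" "?supp t = {(?m, n)}" using Suc.IH Suc.prems(2) by blast
        \<comment> \<open>The shift is injective on exponents containing the second variable; the
          factor \<open>of_nat (lk k 2)\<close> cuts off the others.\<close>
        have "k - unit_exp 2 + unit_exp 1 = ?m \<longleftrightarrow> k = m" if "lk k 2 \<noteq> 0" for k
          using move_back[OF False, of 1] move_back[OF that, of 1] by auto
        moreover have "tcoeff t k l \<noteq> 0 \<longleftrightarrow> k = ?m \<and> l = n" for k l
          using t(2) by (auto simp: set_eq_iff)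
        ultimately have "?supp (tensor_act (E 2 1, 0) t) = {(m, n)}"
          using False by (auto simp: tcoeff_tensor_act_E)
        then show ?thesis using clos(2)[OF t(1)] by blast
      next
        case True
        then have False: "lk n 2 \<noteq> 0" using Suc.prems(3) by simp
        let ?n = "n - unit_exp 2 + unit_exp 1"
        have "total_degree ?n = N" using total_degree_move[OF False] Suc.prems by simp
        moreover have "lk m 2 + lk ?n 2 = d" using Suc.prems(3) False by (simp add: lookup_add lookup_minus)
        ultimately obtain t where t: "t \<in> U" "?supp t = {(m, ?n)}" using Suc.IH Suc.prems(1) by blast
        have "k - unit_exp 2 + unit_exp 1 = ?n \<longleftrightarrow> k = n" if "lk k 2 \<noteq> 0" for k
          using move_back[OF False, of 1] move_back[OF that, of 1] by auto
        moreover have "tcoeff t k l \<noteq> 0 \<longleftrightarrow> k = m \<and> l = ?n" for k l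
          using t(2) by (auto simp: set_eq_iff)
        ultimately have "?supp (tensor_act (0, E 2 1) t) = {(m, n)}"
          using False by (auto simp: tcoeff_tensor_act_E)
        then show ?thesis using clos(4)[OF t(1)] by blast
      qed
    qed
    have "v \<in> U" if v: "v \<in> ?V" for v
    proof -
      have "Poly_Mapping.single p (lk v p) \<in> U" if p: "p \<in> Poly_Mapping.keys v" for p
      proof -
        obtain m n where mn: "p = (m, n)" by (cases p)
        have "tcoeff v m n \<noteq> 0" using p by (simp add: mn tcoeff_def in_keys_iff)
        then have "total_degree m = N" "total_degree n = N" using v by (auto simp: tensor_space_VN_iff)
        then obtain t where t: "t \<in> U" "?supp t = {(m, n)}" using all by blast
        have *: "tcoeff t k l \<noteq> 0 \<longleftrightarrow> k = m \<and> l = n" for k l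
          using t(2) by (auto simp: set_eq_iff)
        then have t0: "lk t q \<noteq> 0 \<longleftrightarrow> q = p" for q
          by (cases q) (simp add: tcoeff_def mn)
        have "Poly_Mapping.single p (lk v p) = pscale (lk v p / lk t p) t"
        proof (rule poly_mapping_eqI)
          fix q
          show "lk (Poly_Mapping.single p (lk v p)) q = lk (pscale (lk v p / lk t p) t) q"
            using t0[of q] by (cases "q = p") (simp_all add: lookup_single)
        qed
        then show ?thesis using t(1) sub by (simp add: pvs.subspace_scale)
      qed
      then have "(\<Sum>p\<in>Poly_Mapping.keys v. Poly_Mapping.single p (lk v p)) \<in> U"
        by (intro pvs.subspace_sum sub)
      then show ?thesis by (simp only: pm_expand[symmetric])
    qed
    then show ?thesis using UV by blast
  qed simp
qed

section \<open>Transport of module structures\<close>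

text \<open>The preimage under \<open>T\<close> of a submodule of \<open>W\<close> is a submodule of
  \<open>V\<close>; \<open>image\<close> turns closure under \<open>H\<close> into closure under
  \<open>G\<close> and back.\<close>

lemma irreducible_transport:
  assumes iso: "module_isomorphic \<theta> G \<rho> V \<sigma> W" and irr: "is_irreducible_submodule G \<rho> V"
    and image: "\<theta> ` G = H"
  shows "is_irreducible_submodule H \<sigma> W"
proof -
  obtain T where bij: "bij_betw T V W"
    and add: "\<And>u v. u \<in> V \<Longrightarrow> v \<in> V \<Longrightarrow> T (u + v) = T u + T v"
    and scale: "\<And>c u. u \<in> V \<Longrightarrow> T (pscale c u) = pscale c (T u)"
    and act: "\<And>g u. g \<in> G \<Longrightarrow> u \<in> V \<Longrightarrow> T (\<rho> g u) = \<sigma> (\<theta> g) (T u)"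
    using iso by (auto simp: module_isomorphic_def)
  have sub: "pvs.subspace V" and clos: "\<And>g u. g \<in> G \<Longrightarrow> u \<in> V \<Longrightarrow> \<rho> g u \<in> V"
    and nz: "V \<noteq> {0}" and min: "\<And>U. is_submodule G \<rho> U \<Longrightarrow> U \<subseteq> V \<Longrightarrow> U = {0} \<or> U = V"
    using irr by (auto simp: is_irreducible_submodule_def is_submodule_def)
  have W: "W = T ` V" and inj: "inj_on T V" using bij by (auto simp: bij_betw_def)
  have V0: "0 \<in> V" using sub by (rule pvs.subspace_0)
  have T0: "T 0 = 0" using scale[OF V0, of 0] by simp
  have Vadd: "u + v \<in> V" and Vscale: "pscale c u \<in> V" if "u \<in> V" "v \<in> V" for u v c
    using that sub by (auto intro: pvs.subspace_add pvs.subspace_scale)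
  show ?thesis
    unfolding is_irreducible_submodule_def
  proof (intro conjI allI impI)
    show "is_submodule H \<sigma> W"
      unfolding is_submodule_def pvs.subspace_def W image[symmetric]
    proof (intro conjI ballI allI)
      show "0 \<in> T ` V" using T0 V0 by (metis image_eqI)
      fix w assume "w \<in> T ` V"
      then obtain u where u: "u \<in> V" "w = T u" by auto
      show "pscale c w \<in> T ` V" for c
        using u by (intro image_eqI[of _ _ "pscale c u"]) (simp_all add: scale Vscale)
      show "X \<in> \<theta> ` G \<Longrightarrow> \<sigma> X w \<in> T ` V" for X
        using u by (auto simp: act[symmetric] intro!: imageI clos)
      show "w' \<in> T ` V \<Longrightarrow> w + w' \<in> T ` V" for w'
        using u by (auto simp: add[symmetric] intro!: imageI Vadd)
    qed
    obtain u where "u \<in> V" "u \<noteq> 0" using nz V0 by blast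
    then have "T u \<in> W" "T u \<noteq> 0" using inj T0 V0 by (auto simp: W inj_on_def)
    then show "W \<noteq> {0}" by auto
    fix U assume U: "is_submodule H \<sigma> U \<and> U \<subseteq> W"
    let ?U = "{u \<in> V. T u \<in> U}"
    have "is_submodule G \<rho> ?U"
      using U V0 T0 image
      by (auto simp: is_submodule_def pvs.subspace_def add scale act clos Vadd Vscale)
    then have "?U = {0} \<or> ?U = V" by (intro min) auto
    moreover have "U = T ` ?U" using U by (auto simp: W)
    ultimately show "U = {0} \<or> U = W" using T0 W by auto
  qed
qed

section \<open>Harmonic decomposition\<close>

context grid
begin

lemma lap_add: "lap (f + g) = lap f + lap g"
  and lap_diff: "lap (f - g) = lap f - lap g"
  and lap_pscale: "lap (pscale c f) = pscale c (lap f)"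
  by (simp_all add: lap_def pd_add pd_diff pd_pscale pvs.scale_right_diff_distrib)

lemma euler_add: "euler (f + g) = euler f + euler g"
  and euler_pscale: "euler (pscale c f) = pscale c (euler f)"
  by (simp_all add: euler_def pd_add pd_pscale distrib_left sum.distrib pscale_mult pvs.scale_sum_right)

lemma homog_lap: "f \<in> homog (Suc (Suc N)) \<Longrightarrow> lap f \<in> homog N"
  unfolding lap_def by (intro homog_minus homog_pd)

lemma lap_homog_less_2:
  assumes "f \<in> homog N" "N < 2" shows "lap f = 0"
proof -
  have "pd v (pd w f) = 0" for v w
  proof (cases N)
    case 0
    then show ?thesis using assms(1) by (simp add: pd_homog_0)
  next
    case (Suc M)
    then have "pd w f \<in> homog 0" using assms by (intro homog_pd) simp
    then show ?thesis by (rule pd_homog_0)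
  qed
  then show ?thesis by (simp add: lap_def)
qed

lemma homog_quad: "f \<in> homog N \<Longrightarrow> quad * f \<in> homog (Suc (Suc N))"
  unfolding quad_def left_diff_distrib mult.assoc by (intro homog_minus homog_var_mult)

lemma homog_quad_power: "f \<in> homog N \<Longrightarrow> quad ^ l * f \<in> homog (N + 2 * l)"
  by (induction l) (simp_all add: homog_quad mult.assoc)

lemma harmonics_subspace: "pvs.subspace (harmonics N)"
proof -
  have "pvs.subspace {f. lap f = 0}"
    using lap_pscale[of 0] by (auto simp: pvs.subspace_def lap_add lap_pscale)
  then show ?thesis unfolding harmonics_def by (intro pvs.subspace_inter homog_subspace)
qed

section \<open>Multiplication of harmonic polynomials by powers of the quadric\<close>

definition component :: "nat \<Rightarrow> nat \<Rightarrow> 'n cpoly set" where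
  "component N l = (*) (quad ^ l) ` harmonics N"

lemma component_subspace: "pvs.subspace (component N l)"
  unfolding pvs.subspace_def component_def
proof (intro conjI ballI allI)
  note sub = harmonics_subspace[of N]
  show "0 \<in> (*) (quad ^ l) ` harmonics N" using pvs.subspace_0[OF sub] by force
  fix f c assume "f \<in> (*) (quad ^ l) ` harmonics N"
  then obtain h where h: "f = quad ^ l * h" "h \<in> harmonics N" by auto
  show "pscale c f \<in> (*) (quad ^ l) ` harmonics N"
    using pvs.subspace_scale[OF sub h(2), of c]
    by (intro image_eqI[of _ _ "pscale c h"]) (simp_all add: h(1) pscale_mult)
  fix g assume "g \<in> (*) (quad ^ l) ` harmonics N"
  then obtain k where k: "g = quad ^ l * k" "k \<in> harmonics N" by auto
  show "f + g \<in> (*) (quad ^ l) ` harmonics N"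
    using pvs.subspace_add[OF sub h(2) k(2)]
    by (intro image_eqI[of _ _ "h + k"]) (simp_all add: h(1) k(1) distrib_left)
qed

text \<open>By \<open>lap_quad\<close> in degree \<open>N + 2 * r\<close>, moving \<open>lap\<close>
  past one factor \<open>quad\<close> contributes \<open>N + 2 * r + 2\<close>. These sum over
  \<open>r\<close> from 0 to \<open>l\<close> to the stated factor, and the final term vanishes
  since \<open>h\<close> is harmonic.\<close>

lemma lap_quad_power:
  assumes "h \<in> harmonics N"
  shows "lap (quad ^ Suc l * h) = of_nat (Suc l * (N + l + 2)) * (quad ^ l * h)"
proof (induction l)
  case 0
  then show ?case
    using assms euler_homog[of h N] by (simp add: lap_quad harmonics_def pscale_of_nat distrib_right)
next
  case (Suc l)
  have "quad ^ Suc l * h \<in> homog (N + 2 * Suc l)"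
    using assms by (intro homog_quad_power) (simp add: harmonics_def)
  then have "euler (quad ^ Suc l * h) = of_nat (N + 2 * Suc l) * (quad ^ Suc l * h)"
    unfolding pscale_of_nat[symmetric] by (rule euler_homog)
  moreover have "quad ^ Suc (Suc l) * h = quad * (quad ^ Suc l * h)"
    by (simp add: mult.assoc)
  ultimately have "lap (quad ^ Suc (Suc l) * h) =
      quad * lap (quad ^ Suc l * h) + of_nat (N + 2 * Suc l) * (quad ^ Suc l * h) + 2 * (quad ^ Suc l * h)"
    by (simp only: lap_quad)
  then show ?case unfolding Suc.IH by (simp add: algebra_simps)
qed

text \<open>\<open>lap\<close> removes one factor \<open>quad\<close> up to a nonzero scalar, so the
  power can be peeled off by induction.\<close>

lemma quad_power_cancel:
  assumes "h \<in> harmonics N" "quad ^ l * h = 0" shows "h = 0"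
  using assms(2)
proof (induction l)
  case (Suc l)
  have "lap 0 = 0" using lap_pscale[of 0 0] by simp
  then have "pscale (of_nat (Suc l * (N + l + 2))) (quad ^ l * h) = 0"
    using lap_quad_power[OF assms(1), of l] Suc.prems by (simp only: pscale_of_nat)
  then have "quad ^ l * h = 0"
    by (simp only: pvs.scale_eq_0_iff of_nat_eq_0_iff) simp
  then show ?case by (rule Suc.IH)
qed simp

lemma quad_power_bij: "bij_betw ((*) (quad ^ l)) (harmonics N) (component N l)"
  unfolding bij_betw_def component_def
proof (intro conjI inj_onI refl)
  fix f g assume fg: "f \<in> harmonics N" "g \<in> harmonics N" "quad ^ l * f = quad ^ l * g"
  then have "quad ^ l * (f - g) = 0" by (simp add: right_diff_distrib)
  then have "f - g = 0"
    by (rule quad_power_cancel[OF pvs.subspace_diff[OF harmonics_subspace fg(1,2)]])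
  then show "f = g" by simp
qed

text \<open>In degree below 2 everything is harmonic. Otherwise \<open>lap f\<close> lies in the
  span for degree \<open>n - 2\<close> and so has a preimage \<open>g\<close> under
  \<open>lap\<close> in the span for degree \<open>n\<close>; then \<open>f - g\<close> is harmonic.
  Fixing the exact degree of \<open>g\<close> keeps \<open>f - g\<close> homogeneous.\<close>

lemma homog_in_span_component:
  "f \<in> homog n \<Longrightarrow> f \<in> pvs.span (\<Union>(N, l)\<in>{(N, l). N + 2 * l = n}. component N l)"
proof (induction n arbitrary: f rule: less_induct)
  case (less n)
  let ?S = "\<lambda>n. pvs.span (\<Union>(N, l)\<in>{(N, l). N + 2 * l = n}. component N l)"
  have harm: "h \<in> ?S n" if "h \<in> harmonics n" for h
    using that by (intro pvs.span_base) (force simp: component_def)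
  show ?case
  proof (cases "n < 2")
    case True
    then show ?thesis
      using less.prems lap_homog_less_2 by (intro harm) (auto simp: harmonics_def)
  next
    case False
    then obtain m where n: "n = Suc (Suc m)" by (metis add_2_eq_Suc le_Suc_ex not_less)
    have "\<exists>g'\<in>?S n \<inter> homog n. lap g' = g" if "g \<in> ?S m" for g
      using that
    proof (induction rule: pvs.span_induct_alt)
      case base
      have "lap 0 = 0" using lap_pscale[of 0 0] by simp
      then show ?case by (metis IntI pvs.span_zero homog_subspace pvs.subspace_0)
    next
      case (step c x y)
      then obtain N l h where x: "N + 2 * l = m" "h \<in> harmonics N" "x = quad ^ l * h"
        by (auto simp: component_def)
      from step obtain y' where y': "y' \<in> ?S n" "y' \<in> homog n" "lap y' = y" by blast
      \<comment> \<open>The scalar of \<open>lap_quad_power\<close>: dividing the next power by it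
        gives a preimage of \<open>quad ^ l * h\<close>.\<close>
      let ?k = "of_nat (Suc l * (N + l + 2)) :: complex"
      let ?x = "pscale (c / ?k) (quad ^ Suc l * h)"
      have "quad ^ Suc l * h \<in> component N (Suc l)" using x by (simp add: component_def)
      moreover have "N + 2 * Suc l = n" using x n by simp
      ultimately have "?x \<in> ?S n" by (intro pvs.span_scale pvs.span_base) blast
      moreover have "quad ^ Suc l * h \<in> homog n"
        using homog_quad_power[of h N "Suc l"] x n by (simp add: harmonics_def)
      then have "?x \<in> homog n" by (intro pvs.subspace_scale homog_subspace)
      moreover have "?k \<noteq> 0" by (simp only: of_nat_eq_0_iff) simp
      then have "lap ?x = pscale c x"
        by (simp only: lap_pscale lap_quad_power[OF x(2)] pscale_of_nat[symmetric] x(3) pvs.scale_scale)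
          simp
      ultimately show ?case
        using y' by (intro bexI[of _ "?x + y'"] IntI)
          (auto simp: lap_add intro: pvs.span_add pvs.subspace_add homog_subspace)
    qed
    moreover have "lap f \<in> ?S m"
      using less.prems by (intro less.IH) (simp_all add: n homog_lap)
    ultimately obtain g where g: "g \<in> ?S n" "g \<in> homog n" "lap g = lap f" by blast
    have "f - g \<in> harmonics n"
      using less.prems g by (auto simp: harmonics_def lap_diff homog_minus)
    then have "(f - g) + g \<in> ?S n" using g(1) by (blast intro: pvs.span_add harm)
    then show ?thesis by simp
  qed
qed

lemma span_component: "pvs.span (\<Union>k. case k of (N, l) \<Rightarrow> component N l) = UNIV"
proof -
  have "f \<in> pvs.span (\<Union>k. case k of (N, l) \<Rightarrow> component N l)" for f
  proof -
    have "Poly_Mapping.single m (lk f m) \<in> pvs.span (\<Union>k. case k of (N, l) \<Rightarrow> component N l)" for m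
    proof -
      have "Poly_Mapping.single m (lk f m) \<in> homog (total_degree m)"
        by (auto simp: homog_iff lookup_single when_def)
      from homog_in_span_component[OF this] show ?thesis
        by (rule subsetD[OF pvs.span_mono, rotated]) auto
    qed
    then have "(\<Sum>m\<in>Poly_Mapping.keys f. Poly_Mapping.single m (lk f m)) \<in>
        pvs.span (\<Union>k. case k of (N, l) \<Rightarrow> component N l)"
      by (intro pvs.span_sum)
    then show ?thesis by (simp only: pm_expand[symmetric])
  qed
  then show ?thesis by blast
qed

text \<open>If \<open>l' = l + d\<close>, the first equation gives \<open>N = N' + 2 * d\<close>,
  and the two products then differ by \<open>d * (N' + d + 1)\<close>, which is positive for
  \<open>d > 0\<close>.\<close>

lemma degree_eigenvalue_inj:
  fixes N l N' l' :: nat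
  assumes "N + 2 * l = N' + 2 * l'" "l * (N + l + 1) = l' * (N' + l' + 1)"
  shows "l = l'"
proof -
  have *: False if less: "l < l'"
    and eqs: "N + 2 * l = N' + 2 * l'" "l * (N + l + 1) = l' * (N' + l' + 1)" for N l N' l' :: nat
  proof -
    obtain d where d: "l' = l + d" "d > 0" using less_imp_add_positive[OF less] by auto
    have "N = N' + 2 * d" using eqs(1) d(1) by simp
    then have "d * (N' + d + 1) = 0" using eqs(2) by (simp add: d(1) algebra_simps)
    then show False using d(2) by simp
  qed
  show ?thesis
    using *[OF _ assms] *[OF _ assms[symmetric]] by (cases l l' rule: linorder_cases) auto
qed

theorem component_direct_sum: "internal_direct_sum (\<lambda>(N, l). component N l) UNIV"
proof (rule internal_direct_sum_eigenspaces)
  \<comment> \<open>The factor \<open>\<i>\<close> merges the eigenvalues of two commuting operators into one.\<close>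
  let ?Z = "\<lambda>f. quad * lap f + pscale \<i> (euler f)"
  let ?e = "\<lambda>(N, l). of_nat (l * (N + l + 1)) + \<i> * of_nat (N + 2 * l) :: complex"
  show "pvs.subspace (case k of (N, l) \<Rightarrow> component N l)" for k
    by (cases k) (simp add: component_subspace)
  show "pvs.span (\<Union>k. case k of (N, l) \<Rightarrow> component N l) = UNIV" by (rule span_component)
  show "?Z (f + g) = ?Z f + ?Z g" for f g
    by (simp add: lap_add euler_add distrib_left pvs.scale_right_distrib)
  show "?Z (pscale c f) = pscale c (?Z f)" for c f
    by (simp add: lap_pscale euler_pscale pvs.scale_right_distrib pscale_mult mult.commute)
  show "?Z f = pscale (?e k) f" if f: "f \<in> (case k of (N, l) \<Rightarrow> component N l)" for k f
  proof -
    obtain N l where k: "k = (N, l)" by (cases k)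
    then obtain h where h: "h \<in> harmonics N" "f = quad ^ l * h" using f by (auto simp: component_def)
    have "f \<in> homog (N + 2 * l)" using h homog_quad_power by (auto simp: harmonics_def)
    then have "euler f = pscale (of_nat (N + 2 * l)) f" by (rule euler_homog)
    moreover have "quad * lap f = pscale (of_nat (l * (N + l + 1))) f"
    proof (cases l)
      case 0
      then show ?thesis using h by (simp add: harmonics_def)
    next
      \<comment> \<open>\<open>lap_quad_power\<close> at \<open>j = l - 1\<close> gives the factor
        \<open>l * (N + l + 1)\<close>.\<close>
      case (Suc j)
      then show ?thesis
        by (simp only: h(2) lap_quad_power[OF h(1)] pscale_of_nat) (simp add: algebra_simps)
    qed
    ultimately show ?thesis by (simp only: k prod.case pvs.scale_left_distrib pvs.scale_scale)
  qed
  show "inj ?e"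
  proof (rule injI)
    fix p q assume eq: "?e p = ?e q"
    obtain N l N' l' where pq: "p = (N, l)" "q = (N', l')" by (cases p, cases q)
    have "Re (?e p) = Re (?e q)" "Im (?e p) = Im (?e q)" using eq by simp_all
    then have "real (l * (N + l + 1)) = real (l' * (N' + l' + 1))" "real (N + 2 * l) = real (N' + 2 * l')"
      unfolding pq by simp_all
    then have e: "l * (N + l + 1) = l' * (N' + l' + 1)" "N + 2 * l = N' + 2 * l'"
      by (simp_all only: of_nat_eq_iff)
    then have "l = l'" using degree_eigenvalue_inj by blast
    then show "p = q" using e(2) pq by simp
  qed
qed

text \<open>The isomorphism is \<open>form\<close> followed by multiplication by
  \<open>quad ^ l\<close>; the hypothesis makes both maps equivariant.\<close>

theorem component_isomorphic:
  assumes "\<And>X Y. X \<in> sl \<Longrightarrow> Y \<in> sl \<Longrightarrow> kronecker_sum X Y (\<theta> (X, Y))"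
  shows "module_isomorphic \<theta> (sl \<times> sl) tensor_act (tensor_space (VN N) (VN N)) act (component N l)"
  unfolding module_isomorphic_def
proof (intro exI conjI ballI allI)
  let ?T = "(*) (quad ^ l) \<circ> form"
  show "bij_betw ?T (tensor_space (VN N) (VN N)) (component N l)"
    by (rule bij_betw_trans[OF form_bij quad_power_bij])
  show "?T (u + v) = ?T u + ?T v" for u v
    by (simp add: form_add distrib_left)
  show "?T (pscale c u) = pscale c (?T u)" for c u
    by (simp add: form_pscale pscale_mult)
  show "?T (tensor_act p u) = act (\<theta> p) (?T u)" if sl: "p \<in> sl \<times> sl" for p u
  proof -
    obtain X Y where p: "p = (X, Y)" "X \<in> sl" "Y \<in> sl" using sl by auto
    note k = assms[OF p(2,3)]
    show ?thesis
      by (simp add: p(1) form_tensor_act[OF k] act_quad_power_mult[OF k p(2,3)])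
  qed
qed

end

section \<open>The identification and the grids\<close>

text \<open>The bracket of \<open>A2star\<close> and \<open>A2\<close> is twice their product, which
  explains the second halving; the three matrices form a basis of the traceless matrices.\<close>

lemma traceless_decomposition:
  assumes "X \<in> sl"
  shows "X = mscale (X $ 1 $ 1) A2star + mscale ((X $ 1 $ 2 + X $ 2 $ 1) / 2) A2 +
     mscale ((X $ 1 $ 2 - X $ 2 $ 1) / 2 / 2) (lie A2star A2)"
proof -
  have "X $ 2 $ 2 = - X $ 1 $ 1"
    using assms by (auto simp: sl_def trace_def sum_2 eq_neg_iff_add_eq_0 add.commute)
  then show ?thesis by (simp add: mat_simps field_simps)
qed

text \<open>The four prescribed values and their brackets determine \<open>\<theta>\<close>, so a
  statement about an arbitrary identification reduces to the explicit embedding.\<close>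

lemma sl2_identification_eq:
  assumes ident: "sl2_identification i j k \<theta>" and jk: "(j, k) \<in> index_pairs" and "X \<in> sl" "Y \<in> sl"
  shows "\<theta> (X, Y) = sl2_embed j k X + sl2_embed k j Y"
proof -
  have kj: "(k, j) \<in> index_pairs" using jk by auto
  have add: "\<theta> (a + a', b + b') = \<theta> (a, b) + \<theta> (a', b')"
    if "a \<in> sl" "a' \<in> sl" "b \<in> sl" "b' \<in> sl" for a a' b b'
  proof -
    have "\<forall>p\<in>sl \<times> sl. \<forall>q\<in>sl \<times> sl. \<theta> (p + q) = \<theta> p + \<theta> q"
      using ident by (simp add: sl2_identification_def)
    from bspec[OF bspec[OF this, of "(a, b)"], of "(a', b')"] that show ?thesis by simp
  qed
  have scale: "\<theta> (mscale c a, mscale c b) = mscale c (\<theta> (a, b))" if "a \<in> sl" "b \<in> sl" for a b c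
    using ident that by (auto simp: sl2_identification_def)
  have lie: "\<theta> (lie a a', lie b b') = lie (\<theta> (a, b)) (\<theta> (a', b'))"
    if "a \<in> sl" "a' \<in> sl" "b \<in> sl" "b' \<in> sl" for a a' b b'
    using ident that by (auto simp: sl2_identification_def)
  have vals: "\<theta> (A2, 0) = A j" "\<theta> (A2star, 0) = Astar k" "\<theta> (0, A2) = A k" "\<theta> (0, A2star) = Astar j"
    using ident by (auto simp: sl2_identification_def)
  have S: "lie A2star A2 \<in> (sl :: (complex^2^2) set)" "\<And>c a. a \<in> sl \<Longrightarrow> mscale c a \<in> (sl :: (complex^2^2) set)"
    "\<And>a b. a \<in> sl \<Longrightarrow> b \<in> sl \<Longrightarrow> a + b \<in> (sl :: (complex^2^2) set)"
    using lie_subalgebra_sl[where 'n = 2] gens_sl2 by (auto simp: lie_subalgebra_def)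
  note mem = S gens_sl2
  have m0: "mscale c (0 :: complex^2^2) = 0" for c by (simp add: mscale_def vec_eq_iff)
  \<comment> \<open>Brackets are formed in one factor at a time, with zero in the other.\<close>
  have brackets: "\<theta> (lie A2star A2, 0) = mscale 2 (Astar k ** A j)"
    "\<theta> (0, lie A2star A2) = mscale 2 (Astar j ** A k)"
    using lie[of A2star A2 0 0] lie[of 0 0 A2star A2] mem
    by (simp_all add: lie_zero vals half_lie[OF jk] half_lie[OF kj] mscale_linear)
  have first: "\<theta> (mscale c a, 0) = mscale c (\<theta> (a, 0))" and second: "\<theta> (0, mscale c a) = mscale c (\<theta> (0, a))"
    if "a \<in> sl" for a c
    using scale[of a 0 c] scale[of 0 a c] that mem by (simp_all add: m0)
  have first_add: "\<theta> (a + a', 0) = \<theta> (a, 0) + \<theta> (a', 0)" and second_add: "\<theta> (0, a + a') = \<theta> (0, a) + \<theta> (0, a')"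
    if "a \<in> sl" "a' \<in> sl" for a a'
    using add[of a a' 0 0] add[of 0 0 a a'] that mem by simp_all
  have combination:
    "\<theta> (mscale p A2star + mscale q A2 + mscale (r / 2) (lie A2star A2), 0) =
      mscale p (Astar k) + mscale q (A j) + mscale r (Astar k ** A j)"
    "\<theta> (0, mscale p A2star + mscale q A2 + mscale (r / 2) (lie A2star A2)) =
      mscale p (Astar j) + mscale q (A k) + mscale r (Astar j ** A k)" for p q r
    by (simp_all add: first_add second_add first second mem vals brackets mscale_linear)
  have "\<theta> (X, 0) = sl2_embed j k X" "\<theta> (0, Y) = sl2_embed k j Y"
    using combination(1)[of "X $ 1 $ 1" "(X $ 1 $ 2 + X $ 2 $ 1) / 2" "(X $ 1 $ 2 - X $ 2 $ 1) / 2"]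
      combination(2)[of "Y $ 1 $ 1" "(Y $ 1 $ 2 + Y $ 2 $ 1) / 2" "(Y $ 1 $ 2 - Y $ 2 $ 1) / 2"]
    unfolding traceless_decomposition[OF assms(3), symmetric]
      traceless_decomposition[OF assms(4), symmetric]
    by (simp_all add: sl2_embed_def)
  then show ?thesis using add[of X 0 0 Y] assms(3,4) mem by simp
qed

text \<open>The placement is dictated by \<open>(A, 0) \<mapsto> A\<^sub>j\<close>, which has to exchange the rows, and
  \<open>(0, A) \<mapsto> A\<^sub>k\<close>, which has to exchange the columns.\<close>

definition var_grid :: "nat \<Rightarrow> nat \<Rightarrow> nat \<Rightarrow> 2 \<times> 2 \<Rightarrow> 4" where
  "var_grid i j k p = (if p = (1, 1) then 1 else if p = (2, 2) then of_nat (i + 1)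
     else if p = (2, 1) then of_nat (j + 1) else of_nat (k + 1))"

lemma triple_cases:
  fixes i j k :: nat
  assumes "{i, j, k} = {1, 2, 3}"
  shows "(i, j, k) \<in> {(1, 2, 3), (1, 3, 2), (2, 1, 3), (2, 3, 1), (3, 1, 2), (3, 2, 1)}"
proof -
  have "card {i, j, k} = card {1, 2, 3 :: nat}" by (rule arg_cong[OF assms])
  then have "i \<noteq> j" "i \<noteq> k" "j \<noteq> k"
    by (auto simp: card_insert_if split: if_splits)
  moreover have "i \<in> {1, 2, 3}" "j \<in> {1, 2, 3}" "k \<in> {1, 2, 3}" unfolding assms[symmetric] by simp_all
  ultimately show ?thesis by (elim insertE emptyE) simp_all
qed

text \<open>Injectivity is a finite check, and both types have four elements.\<close>

lemma grid_var_grid: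
  assumes "{i, j, k} = {1, 2, 3}"
  shows "grid (var_grid i j k)"
proof
  have "inj (var_grid i j k)"
  proof (rule injI)
    fix p q assume eq: "var_grid i j k p = var_grid i j k q"
    obtain a b c d where pq: "p = (a, b)" "q = (c, d)" by (cases p, cases q)
    show "p = q"
      using triple_cases[OF assms] exhaust_2[of a] exhaust_2[of b] exhaust_2[of c] exhaust_2[of d] eq
      unfolding pq var_grid_def
      by (elim insertE emptyE disjE) simp_all
  qed
  moreover have "card (range (var_grid i j k)) = card (UNIV :: 4 set)"
    using \<open>inj _\<close> by (simp add: card_image card_cartesian_product flip: UNIV_Times_UNIV)
  then have "range (var_grid i j k) = UNIV" by (intro card_subset_eq) auto
  ultimately show "bij (var_grid i j k)" by (simp add: bij_def)
qed

text \<open>On this grid \<open>A j\<close> exchanges the rows and \<open>Astar k\<close> is the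
  sign of the row, while \<open>A k\<close> and \<open>Astar j\<close> do the same for
  columns.\<close>

lemma kronecker_sum_embed:
  assumes "{i, j, k} = {1, 2, 3}" "X \<in> sl" "Y \<in> sl"
  shows "grid.kronecker_sum (var_grid i j k) X Y (sl2_embed j k X + sl2_embed k j Y)"
proof -
  have tr: "X $ 2 $ 2 = - X $ 1 $ 1" "Y $ 2 $ 2 = - Y $ 1 $ 1"
    using assms(2,3) by (auto simp: sl_def trace_def sum_2 eq_neg_iff_add_eq_0 add.commute)
  show ?thesis
    using triple_cases[OF assms(1)]
    unfolding grid.kronecker_sum_def[OF grid_var_grid[OF assms(1)]]
    by (elim insertE emptyE; simp add: var_grid_def forall_2 mat_simps tr; simp add: field_simps)
qed

text \<open>The diagonal holds the variables numbered 1 and \<open>i + 1\<close>, the antidiagonal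
  the other two; \<open>mult.commute\<close> absorbs their order.\<close>

lemma R_eq_quad:
  assumes "{i, j, k} = {1, 2, 3}"
  shows "R i f = grid.quad (var_grid i j k) * f"
  using triple_cases[OF assms]
  unfolding grid.quad_def[OF grid_var_grid[OF assms]]
  by (elim insertE emptyE) (simp_all add: R_def var_grid_def mult.commute)

lemma L_eq_lap:
  assumes "{i, j, k} = {1, 2, 3}"
  shows "L i f = grid.lap (var_grid i j k) f"
  using triple_cases[OF assms]
  unfolding grid.lap_def[OF grid_var_grid[OF assms]]
  by (elim insertE emptyE) (simp_all add: L_def var_grid_def pd_commute)

lemma summand_eq_component:
  assumes "{i, j, k} = {1, 2, 3}"
  shows "summand i N l = grid.component (var_grid i j k) N l"
proof -
  interpret grid "var_grid i j k" using assms by (rule grid_var_grid)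
  have "(R i ^^ l) f = quad ^ l * f" for f
    by (induction l) (simp_all add: R_eq_quad[OF assms] mult.assoc)
  then show ?thesis
    by (simp add: summand_def component_def harmonics_def L_eq_lap[OF assms])
qed

theorem proposition14p1:
  fixes i :: nat
  assumes "i \<in> {1, 2, 3}"
  shows "internal_direct_sum (\<lambda>(N, l). summand i N l) (UNIV :: 4 cpoly set) \<and>
    (\<forall>N l. is_irreducible_submodule (lie_sub i) act (summand i N l)) \<and>
    (\<forall>j k \<theta>. {i, j, k} = {1, 2, 3} \<and> sl2_identification i j k \<theta> \<longrightarrow>
       (\<forall>N l. module_isomorphic \<theta> (sl \<times> sl) tensor_act (tensor_space (VN N) (VN N))
                act (summand i N l)))"
proof -
  have iso: "module_isomorphic \<theta> (sl \<times> sl) tensor_act (tensor_space (VN N) (VN N)) act (summand i N l)"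
    if ijk: "{i, j, k} = {1, 2, 3}" and ident: "sl2_identification i j k \<theta>" for j k \<theta> N l
  proof -
    have "(j, k) \<in> index_pairs" using triple_cases[OF ijk] by auto
    then show ?thesis
      unfolding summand_eq_component[OF ijk]
      using kronecker_sum_embed[OF ijk] sl2_identification_eq[OF ident]
      by (intro grid.component_isomorphic[OF grid_var_grid[OF ijk]]) simp
  qed
  obtain j k where ijk: "{i, j, k} = {1, 2, 3}"
  proof -
    have "{i, 2, 3} = {1, 2, 3} \<or> {i, 1, 3} = {1, 2, 3} \<or> {i, 1, 2} = {1, 2, 3}"
      using assms by auto
    then show ?thesis using that by blast
  qed
  have "internal_direct_sum (\<lambda>(N, l). summand i N l) UNIV"
    unfolding summand_eq_component[OF ijk] by (rule grid.component_direct_sum[OF grid_var_grid[OF ijk]])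
  moreover have "is_irreducible_submodule (lie_sub i) act (summand i N l)" for N l
  proof -
    \<comment> \<open>Irreducibility over \<open>lie_sub i\<close> does not refer to an
      identification, so any one can carry it over from the tensor square.\<close>
    obtain \<theta> where \<theta>: "sl2_identification i j k \<theta>" using sl2_identification_exists[OF ijk] by blast
    then have "\<theta> ` (sl \<times> sl) = lie_sub i" by (simp add: sl2_identification_def bij_betw_def)
    with iso[OF ijk \<theta>] tensor_space_irreducible show ?thesis by (rule irreducible_transport)
  qed
  ultimately show ?thesis using iso by blast
qed

end
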